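(* Let $n\ge 2$. The assignment $\widehat{\rho}_B$ given on $Cb_n$ by setting $t_1=\dots=t_n=t$ in the matrices $\widehat{\rho}_G(\varepsilon_{ij})$, and on $S_n\le \mathrm{Aut}(F_n)$ by the corresponding permutation matrices, defines a representation $\widehat{\rho}_B: C_n=Cb_n\rtimes S_n\to \mathrm{GL}_n(\mathbb{Z}[t^{\pm1}])$, and $\widehat{\rho}_B$ is an extension of the Burau representation $\rho_B$ of the braid group $B_n\le C_n$; that is, the restriction of $\widehat{\rho}_B$ to $B_n$ equals $\rho_B$.
   Context: $F_n$ is the free group with free basis $x_1,\dots,x_n$. Automorphisms act on the right, so in a product $\alpha\beta$ the automorphism $\alpha$ is applied first: $x^{\alpha\beta}=(x^\alpha)^\beta$. $C_n$ is the group of conjugating automorphisms of $F_n$: automorphisms sending each $x_i$ to $f_i^{-1}x_{\pi(i)}f_i$ for some permutation $\pi$ of $\{1,\dots,n\}$ and $f_i\in F_n$. $Cb_n$ is the normal subgroup of those with $\pi=\mathrm{id}$; it is generated (McCool) by $\varepsilon_{ij}$, $1\le i\ne j\le n$, where $\varepsilon_{ij}$ maps $x_i\mapsto x_j^{-1}x_ix_j$ and $x_l\mapsto x_l$ for $l\ne i$. $C_n$ is the semidirect product of $Cb_n$ with the group $S_n$ of automorphisms permuting the basis $x_1,\dots,x_n$ (Savushkina). The braid group $B_n$ (generators $\sigma_1,\dots,\sigma_{n-1}$, relations $\sigma_i\sigma_{i+1}\sigma_i=\sigma_{i+1}\sigma_i\sigma_{i+1}$ and $\sigma_i\sigma_j=\sigma_j\sigma_i$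 for $|i-j|\ge2$) is embedded in $C_n$ by letting $\sigma_i$ act as $x_i\mapsto x_ix_{i+1}x_i^{-1}$, $x_{i+1}\mapsto x_i$, $x_l\mapsto x_l$ for $l\ne i,i+1$. Fox derivatives $\partial/\partial x_j:\mathbb{Z}F_n\to\mathbb{Z}F_n$ are the additive maps with $\partial x_i/\partial x_j=\delta_{ij}$ and $\partial(wv)/\partial x_j=(\partial w/\partial x_j)\,v^\tau+w\,\partial v/\partial x_j$, where $\tau:\mathbb{Z}F_n\to\mathbb{Z}$ is the augmentation. The Burau representation is $\rho_B(\beta)=\left[\left(\partial(x_i^\beta)/\partial x_j\right)^\psi\right]_{i,j=1}^n\in\mathrm{GL}_n(\mathbb{Z}[t^{\pm1}])$ for $\beta\in B_n$, where $\psi:\mathbb{Z}F_n\to\mathbb{Z}[t^{\pm1}]$ is induced by $x_i\mapsto t$ for all $i$. Matrices act from the right on the free left module with basis $e_1,\dots,e_n$ (so $e_iM$ is the $i$-th row of $M$). The matrix $\widehat{\rho}_G(\varepsilon_{ij})$ over $\mathbb{Z}[t_1^{\pm1},\dots,t_n^{\pm1}]$ is given by $e_i\mapsto t_j^{-1}(t_i-1)e_j+t_j^{-1}e_i$, $e_l\mapsto e_l$ for $l\ne i$. Thus $\widehat{\rho}_B(\varepsilon_{ij})$ is $e_i\mapsto t^{-1}(t-1)e_j+t^{-1}e_i$, $e_l\mapsto e_l$ for $l\neq i$. For an automorphism $x_i\mapsto x_{\pi(i)}$ in $S_n$, its image under $\widehat{\rho}_B$ is the matrix of $e_i\mapsto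 e_{\pi(i)}$. *)

theory Defs
  imports
    "HOL-Algebra.Coset"
    "HOL-Algebra.Bij"
    "HOL-Combinatorics.Permutations"
    "HOL-Library.Poly_Mapping"
    "Jordan_Normal_Form.Matrix"
begin

section \<open>Free groups\<close>

text \<open>
  The free group on the generators \<open>'a\<close>: words in the letters \<open>(a, False)\<close> (the generator
  \<open>a\<close>) and \<open>(a, True)\<close> (its inverse), modulo cancellation. It is made an instance of the
  non-commutative class \<^class>\<open>group_add\<close>, so that \<open>v + w\<close> is the product of \<open>v\<close> and \<open>w\<close>,
  \<open>- w\<close> is the inverse of \<open>w\<close>, and the library type \<open>'a free_grp \<Rightarrow>\<^sub>0 int\<close>, whose
  product is convolution, is the integral group ring.
\<close>

inductive cancels :: "('a \<times> bool) list \<Rightarrow> ('a \<times> bool) list \<Rightarrow> bool" where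
  "cancels (u @ [(a, b), (a, \<not> b)] @ v) (u @ v)"

definition free_eq :: "('a \<times> bool) list \<Rightarrow> ('a \<times> bool) list \<Rightarrow> bool" where
  "free_eq = equivclp cancels"

lemma free_eqI: "cancels u v \<Longrightarrow> free_eq u v"
  unfolding free_eq_def by (rule r_into_equivclp)

lemma free_eq_refl: "free_eq u u"
  unfolding free_eq_def by simp

lemma free_eq_sym: "free_eq u v \<Longrightarrow> free_eq v u"
  unfolding free_eq_def by (rule equivclp_sym)

lemma free_eq_trans: "free_eq u v \<Longrightarrow> free_eq v w \<Longrightarrow> free_eq u w"
  unfolding free_eq_def by (rule equivclp_trans)

lemma free_eq_induct:
  assumes "free_eq u v"
    and "\<And>u v. cancels u v \<Longrightarrow> P u v" and "\<And>u. P u u"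
    and "\<And>u v. P u v \<Longrightarrow> P v u" and "\<And>u v w. P u v \<Longrightarrow> P v w \<Longrightarrow> P u w"
  shows "P u v"
  using assms(1) unfolding free_eq_def
  by (induction rule: equivclp_induct) (use assms(2-) in blast)+

lemma free_eq_map:
  assumes "\<And>u v. cancels u v \<Longrightarrow> free_eq (f u) (f v)" and "free_eq u v"
  shows "free_eq (f u) (f v)"
  using assms(2) by (rule free_eq_induct) (blast intro: assms(1) free_eq_refl free_eq_sym free_eq_trans)+

lemma free_eq_append:
  assumes "free_eq u u'" "free_eq v v'"
  shows "free_eq (u @ v) (u' @ v')"
proof (rule free_eq_trans)
  show "free_eq (u @ v) (u' @ v)"
    using assms(1)
    by (rule free_eq_map[rotated]) (metis append.assoc cancels.simps free_eqI)
  show "free_eq (u' @ v) (u' @ v')"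
    using assms(2)
    by (rule free_eq_map[rotated]) (metis append.assoc cancels.simps free_eqI)
qed

definition inv_word :: "('a \<times> bool) list \<Rightarrow> ('a \<times> bool) list" where
  "inv_word w = rev (map (\<lambda>(a, b). (a, \<not> b)) w)"

lemma free_eq_inv_word:
  assumes "free_eq u v"
  shows "free_eq (inv_word u) (inv_word v)"
  using assms
proof (rule free_eq_map[rotated])
  fix u v :: "('a \<times> bool) list"
  assume "cancels u v"
  then obtain p a b q where "u = p @ [(a, b), (a, \<not> b)] @ q" "v = p @ q"
    by (auto elim: cancels.cases)
  then have "inv_word u = inv_word q @ [(a, b), (a, \<not> b)] @ inv_word p"
    "inv_word v = inv_word q @ inv_word p"
    by (auto simp: inv_word_def)
  then show "free_eq (inv_word u) (inv_word v)"
    by (metis cancels.intros free_eqI)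
qed

lemma free_eq_inv_word_append: "free_eq (inv_word w @ w) []"
proof (induction w)
  case Nil
  then show ?case by (simp add: inv_word_def free_eq_refl)
next
  case (Cons x w)
  obtain a b where x: "x = (a, b)" by (cases x)
  have "cancels (inv_word w @ [(a, \<not> b), (a, \<not> \<not> b)] @ w) (inv_word w @ w)"
    by (rule cancels.intros)
  then have "free_eq (inv_word (x # w) @ (x # w)) (inv_word w @ w)"
    by (simp add: inv_word_def x free_eqI)
  then show ?case using Cons.IH free_eq_trans by blast
qed

quotient_type 'a free_grp = "('a \<times> bool) list" / free_eq
  by (simp add: free_eq_def)

instantiation free_grp :: (type) group_add
begin

lift_definition zero_free_grp :: "'a free_grp" is "[]" .

lift_definition plus_free_grp :: "'a free_grp \<Rightarrow> 'a free_grp \<Rightarrow> 'a free_grp" is "(@)"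
  by (rule free_eq_append)

lift_definition uminus_free_grp :: "'a free_grp \<Rightarrow> 'a free_grp" is inv_word
  by (rule free_eq_inv_word)

definition minus_free_grp :: "'a free_grp \<Rightarrow> 'a free_grp \<Rightarrow> 'a free_grp" where
  "minus_free_grp v w = v + - w"

instance
proof
  fix u v w :: "'a free_grp"
  show "u + v + w = u + (v + w)" by transfer (simp add: free_eq_refl)
  show "0 + u = u" by transfer (simp add: free_eq_refl)
  show "u + 0 = u" by transfer (simp add: free_eq_refl)
  show "- u + u = 0" by transfer (rule free_eq_inv_word_append)
  show "u + - v = u - v" by (simp add: minus_free_grp_def)
qed

end

lift_definition gen :: "'a \<Rightarrow> 'a free_grp" is "\<lambda>a. [(a, False)]" .

text \<open>The homomorphism to a group \<open>'g\<close> that sends each generator \<open>a\<close> to \<open>f a\<close>.\<close>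

lift_definition free_lift :: "('a \<Rightarrow> 'g::group_add) \<Rightarrow> 'a free_grp \<Rightarrow> 'g"
  is "\<lambda>f w. sum_list (map (\<lambda>(a, b). if b then - f a else f a) w)"
  subgoal for f u v
    by (erule free_eq_induct) (auto simp: add.assoc elim!: cancels.cases)
  done

lemma free_lift_gen: "free_lift f (gen a) = f a"
  by transfer simp

lemma free_lift_add: "free_lift f (v + w) = free_lift f v + free_lift f w"
  by transfer simp

text \<open>
  The group \<open>F\<^sub>n\<close>, written with the basis \<open>gen 0, \<dots>, gen (n - 1)\<close>: the subgroup of the free
  group on \<^typ>\<open>nat\<close> given by the words in the letters with index below \<open>n\<close>.
\<close>

definition free_group :: "nat \<Rightarrow> nat free_grp monoid" where
  "free_group n = \<lparr>carrier = {abs_free_grp w |w. fst ` set w \<subseteq> {..<n}}, monoid.mult = (+), one = 0\<rparr>"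


section \<open>Conjugating automorphisms\<close>

text \<open>\<open>Aut F\<^sub>n\<close> acts on the right: in a product \<open>\<alpha> \<otimes> \<beta>\<close> the factor \<open>\<alpha>\<close> is applied first.\<close>

definition aut_group :: "nat \<Rightarrow> (nat free_grp \<Rightarrow> nat free_grp) monoid" where
  "aut_group n =
    \<lparr>carrier = auto (free_group n),
     monoid.mult = (\<lambda>\<alpha> \<beta>. compose (carrier (free_group n)) \<beta> \<alpha>),
     one = (\<lambda>w\<in>carrier (free_group n). w)\<rparr>"

definition conj_aut_group :: "nat \<Rightarrow> (nat free_grp \<Rightarrow> nat free_grp) monoid" where
  "conj_aut_group n = (aut_group n)
    \<lparr>carrier := {\<alpha> \<in> carrier (aut_group n). \<exists>\<pi>. \<pi> permutes {..<n} \<and>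
      (\<forall>i<n. \<exists>f\<in>carrier (free_group n). \<alpha> (gen i) = - f + gen (\<pi> i) + f)}\<rparr>"

definition endo :: "nat \<Rightarrow> (nat \<Rightarrow> nat free_grp) \<Rightarrow> nat free_grp \<Rightarrow> nat free_grp" where
  "endo n f = restrict (free_lift f) (carrier (free_group n))"

definition eps :: "nat \<Rightarrow> nat \<Rightarrow> nat \<Rightarrow> nat free_grp \<Rightarrow> nat free_grp" where
  "eps n i j = endo n (\<lambda>l. if l = i then - gen j + gen i + gen j else gen l)"

definition perm_aut :: "nat \<Rightarrow> (nat \<Rightarrow> nat) \<Rightarrow> nat free_grp \<Rightarrow> nat free_grp" where
  "perm_aut n \<pi> = endo n (\<lambda>l. gen (\<pi> l))"


section \<open>The braid group\<close>

text \<open>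
  The generators \<open>\<sigma>\<^sub>1, \<dots>, \<sigma>\<^sub>n\<^sub>-\<^sub>1\<close> become \<open>gen 0, \<dots>, gen (n - 2)\<close>, and \<open>B\<^sub>n\<close> is the
  quotient of the free group on them by the normal closure of the relators.
\<close>

definition braid_relators :: "nat \<Rightarrow> nat free_grp set" where
  "braid_relators n =
    {gen i + gen (i + 1) + gen i - (gen (i + 1) + gen i + gen (i + 1)) |i. i + 2 < n} \<union>
    {gen i + gen j - (gen j + gen i) |i j. i + 1 < n \<and> j + 1 < n \<and> (i + 2 \<le> j \<or> j + 2 \<le> i)}"

definition braid_kernel :: "nat \<Rightarrow> nat free_grp set" where
  "braid_kernel n = \<Inter>{N. N \<lhd> free_group (n - 1) \<and> braid_relators n \<subseteq> N}"

definition braid_group :: "nat \<Rightarrow> nat free_grp set monoid" where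
  "braid_group n = free_group (n - 1) Mod braid_kernel n"

definition braid_sigma :: "nat \<Rightarrow> nat \<Rightarrow> nat free_grp set" where
  "braid_sigma n i = braid_kernel n #>\<^bsub>free_group (n - 1)\<^esub> gen i"

definition artin_aut :: "nat \<Rightarrow> nat \<Rightarrow> nat free_grp \<Rightarrow> nat free_grp" where
  "artin_aut n i = endo n (\<lambda>l. if l = i then gen i + gen (i + 1) - gen i
                              else if l = i + 1 then gen i else gen l)"

definition artin_embedding ::
    "nat \<Rightarrow> nat free_grp set \<Rightarrow> nat free_grp \<Rightarrow> nat free_grp" where
  "artin_embedding n = (THE \<iota>.
     \<iota> \<in> hom (braid_group n) (conj_aut_group n) \<inter> extensional (carrier (braid_group n)) \<and>
     (\<forall>i. i + 1 < n \<longrightarrow> \<iota> (braid_sigma n i) = artin_aut n i))"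


section \<open>Fox derivatives and the Burau representation\<close>

definition augmentation :: "('a free_grp \<Rightarrow>\<^sub>0 int) \<Rightarrow> int" where
  "augmentation p = (\<Sum>g\<in>Poly_Mapping.keys p. Poly_Mapping.lookup p g)"

text \<open>
  The derivatives live on the group ring of the free group on \<^typ>\<open>nat\<close>; the derivatives
  on \<open>\<int>F\<^sub>n\<close> are their restrictions.
\<close>

definition fox_derivation ::
    "'a \<Rightarrow> (('a free_grp \<Rightarrow>\<^sub>0 int) \<Rightarrow> ('a free_grp \<Rightarrow>\<^sub>0 int)) \<Rightarrow> bool" where
  "fox_derivation j D \<longleftrightarrow>
    (\<forall>p q. D (p + q) = D p + D q) \<and>
    (\<forall>i. D (Poly_Mapping.single (gen i) 1) = (if i = j then 1 else 0)) \<and>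
    (\<forall>p q. D (p * q) = D p * of_int (augmentation q) + p * D q)"

definition fox :: "'a \<Rightarrow> ('a free_grp \<Rightarrow>\<^sub>0 int) \<Rightarrow> ('a free_grp \<Rightarrow>\<^sub>0 int)" where
  "fox j = (THE D. fox_derivation j D)"

text \<open>\<open>\<int>[t, t\<^sup>-\<^sup>1]\<close> is the group ring of \<open>\<int>\<close>: the monomial \<open>t\<^sup>k\<close> is \<open>tpow k\<close>.\<close>

type_synonym laurent = "int \<Rightarrow>\<^sub>0 int"

definition tpow :: "int \<Rightarrow> laurent" where
  "tpow k = Poly_Mapping.single k 1"

text \<open>The ring homomorphism sending every generator to \<open>t\<close>.\<close>

definition psi :: "('a free_grp \<Rightarrow>\<^sub>0 int) \<Rightarrow> laurent" where
  "psi p = (\<Sum>g\<in>Poly_Mapping.keys p.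
              of_int (Poly_Mapping.lookup p g) * tpow (free_lift (\<lambda>_. 1) g))"

definition GL :: "nat \<Rightarrow> laurent mat monoid" where
  "GL n = units_of (ring_mat TYPE(laurent) n ())"

definition burau :: "nat \<Rightarrow> nat free_grp set \<Rightarrow> laurent mat" where
  "burau n b = mat n n (\<lambda>(i, j).
     psi (fox j (Poly_Mapping.single (artin_embedding n b (gen i)) 1)))"


section \<open>The extension to conjugating automorphisms\<close>

definition eps_mat :: "nat \<Rightarrow> nat \<Rightarrow> nat \<Rightarrow> laurent mat" where
  "eps_mat n i j = mat n n (\<lambda>(l, k).
     if l = i then (if k = j then tpow (- 1) * (tpow 1 - 1) else if k = i then tpow (- 1) else 0)
     else if k = l then 1 else 0)"

definition perm_mat :: "nat \<Rightarrow> (nat \<Rightarrow> nat) \<Rightarrow> laurent mat" where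
  "perm_mat n \<pi> = mat n n (\<lambda>(l, k). if k = \<pi> l then 1 else 0)"

definition is_rho_hat :: "nat \<Rightarrow> ((nat free_grp \<Rightarrow> nat free_grp) \<Rightarrow> laurent mat) \<Rightarrow> bool" where
  "is_rho_hat n \<rho> \<longleftrightarrow>
    \<rho> \<in> hom (conj_aut_group n) (GL n) \<inter> extensional (carrier (conj_aut_group n)) \<and>
    (\<forall>i<n. \<forall>j<n. i \<noteq> j \<longrightarrow> \<rho> (eps n i j) = eps_mat n i j) \<and>
    (\<forall>\<pi>. \<pi> permutes {..<n} \<longrightarrow> \<rho> (perm_aut n \<pi>) = perm_mat n \<pi>)"

end

theory Submission
  imports Defs "HOL-Algebra.Generated_Groups"
begin

text \<open>
  The extension is the Burau formula itself. For an endomorphism \<open>\<alpha>\<close> of \<open>F\<^sub>n\<close> let \<open>jacobian n \<alpha>\<close> be the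
  matrix of the Fox derivatives of the words \<open>\<alpha> (gen i)\<close>, with all generators specialised to \<open>t\<close>.
  The chain rule makes the Jacobian of a composite a product in which the first factor is
  transported by the second automorphism. A conjugating automorphism sends each generator to a
  conjugate of a generator, so it preserves the total degree of words, and the transport disappears
  under the specialisation (\<open>fox_laurent_chain\<close>, \<open>jacobian_mult\<close>). Thus the Jacobian is a
  representation of the whole group \<open>C\<^sub>n\<close>; it takes the prescribed values on \<open>eps n i j\<close> and on
  permutations by direct computation (\<open>jacobian_eps\<close>, \<open>jacobian_perm\<close>), and on braids it is the
  Burau matrix by definition.

  Uniqueness needs that \<open>C\<^sub>n\<close> is generated by the \<open>eps n i j\<close> and the permutations
  (\<open>generate_conj_aut_group\<close>). Write \<open>\<alpha> (gen i) = p\<^sub>i + gen (\<pi> i) - p\<^sub>i\<close> with words \<open>p\<^sub>i\<close> and argue by induction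
  on their total length. If some \<open>p\<^sub>i\<close> is not reduced, or ends in a letter of index \<open>\<pi> i\<close>, it can be
  shortened without changing \<open>\<alpha>\<close>. If \<open>p\<^sub>i\<close> begins with \<open>p\<^sub>j\<close> followed by a letter of index \<open>\<pi> j\<close>, then
  multiplying \<open>\<alpha>\<close> on the left by \<open>eps n i j\<close> or its inverse removes that letter from \<open>p\<^sub>i\<close>. Otherwise no
  middle letter \<open>gen (\<pi> i)\<close> ever cancels in a reduced product of the \<open>\<alpha> (gen i)\<close> and their
  inverses (\<open>image_of_reduced_word\<close>), so the reduced form of such a product starts with \<open>p\<^sub>i\<close> and a
  letter of index \<open>\<pi> i\<close>. By surjectivity each single generator is such a product, which forces
  all \<open>p\<^sub>i\<close> to be empty (\<open>tight_independent_imp_trivial\<close>), and \<open>\<alpha>\<close> is a permutation.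

  The Fox derivatives and the embedding of the braid group are given by definite descriptions;
  \<open>fox_conv_linear_extension\<close> and \<open>ex1_artin_embedding\<close> show that these describe something.
\<close>

section \<open>Words and free groups\<close>

definition letter :: "'a \<times> bool \<Rightarrow> 'a free_grp" where
  "letter x = (if snd x then - gen (fst x) else gen (fst x))"

definition flip :: "'a \<times> bool \<Rightarrow> 'a \<times> bool" where
  "flip x = (fst x, \<not> snd x)"

lemma flip_flip [simp]: "flip (flip x) = x"
  by (simp add: flip_def)

lemma letter_pair [simp]: "letter (a, False) = gen a" "letter (a, True) = - gen a"
  by (simp_all add: letter_def)

lemma letter_flip [simp]: "letter (flip x) = - letter x"
  by (simp add: letter_def flip_def)

lemma abs_free_grp_append: "abs_free_grp (u @ v) = abs_free_grp u + abs_free_grp v"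
  by (simp add: plus_free_grp.abs_eq)

lemma abs_free_grp_Nil [simp]: "abs_free_grp [] = 0"
  by (simp add: zero_free_grp_def)

lemma abs_free_grp_singleton: "abs_free_grp [x] = letter x"
proof (cases x)
  case (Pair a b)
  have "- gen a = abs_free_grp [(a, True)]"
    by (simp add: gen.abs_eq uminus_free_grp.abs_eq inv_word_def)
  then show ?thesis
    using Pair by (simp add: letter_def gen.abs_eq)
qed

lemma abs_free_grp_Cons: "abs_free_grp (x # w) = letter x + abs_free_grp w"
  using abs_free_grp_append[of "[x]" w] by (simp add: abs_free_grp_singleton)

lemmas abs_free_grp_simps = abs_free_grp_append abs_free_grp_Cons

lemma abs_free_grp_eq_iff: "abs_free_grp u = abs_free_grp v \<longleftrightarrow> free_eq u v"
  using Quotient3_rel_abs[OF Quotient3_free_grp] Quotient3_rel[OF Quotient3_free_grp]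
  by (metis free_eq_refl)

lemma abs_free_grp_cases: obtains w where "g = abs_free_grp w"
  by (metis Quotient3_abs_rep Quotient3_free_grp)

lemma free_grp_induct [case_names zero gen neg]:
  assumes "P 0" and "\<And>a w. P w \<Longrightarrow> P (gen a + w)" and "\<And>a w. P w \<Longrightarrow> P (- gen a + w)"
  shows "P g"
proof -
  obtain w where "g = abs_free_grp w"
    by (rule abs_free_grp_cases)
  moreover have "P (abs_free_grp w)"
    by (induction w) (auto simp: abs_free_grp_Cons letter_def assms)
  ultimately show ?thesis
    by simp
qed

lemma abs_free_grp_in_free_group: "fst ` set w \<subseteq> {..<n} \<Longrightarrow> abs_free_grp w \<in> carrier (free_group n)"
  by (auto simp: free_group_def)

lemma free_group_cases:
  assumes "g \<in> carrier (free_group n)"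
  obtains w where "g = abs_free_grp w" "fst ` set w \<subseteq> {..<n}"
  using assms by (auto simp: free_group_def)

lemma mult_free_group [simp]: "v \<otimes>\<^bsub>free_group n\<^esub> w = v + w"
  and one_free_group [simp]: "\<one>\<^bsub>free_group n\<^esub> = 0"
  by (simp_all add: free_group_def)

lemma zero_in_free_group [simp]: "0 \<in> carrier (free_group n)"
  using abs_free_grp_in_free_group[of "[]" n] by simp

lemma gen_in_free_group [simp]: "a < n \<Longrightarrow> gen a \<in> carrier (free_group n)"
  using abs_free_grp_in_free_group[of "[(a, False)]" n] by (simp add: abs_free_grp_singleton)

lemma add_in_free_group [simp]:
  assumes "v \<in> carrier (free_group n)" "w \<in> carrier (free_group n)"
  shows "v + w \<in> carrier (free_group n)"
proof -
  obtain v' w' where "v = abs_free_grp v'" "w = abs_free_grp w'"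
    and "fst ` set v' \<subseteq> {..<n}" "fst ` set w' \<subseteq> {..<n}"
    using assms by (auto elim!: free_group_cases)
  then show ?thesis
    using abs_free_grp_in_free_group[of "v' @ w'" n] by (auto simp: abs_free_grp_append)
qed

lemma uminus_in_free_group [simp]:
  assumes "v \<in> carrier (free_group n)"
  shows "- v \<in> carrier (free_group n)"
proof -
  obtain w where w: "v = abs_free_grp w" "fst ` set w \<subseteq> {..<n}"
    using assms by (rule free_group_cases)
  have "fst ` set (inv_word w) = fst ` set w"
    by (force simp: inv_word_def image_iff)
  with w show ?thesis
    using abs_free_grp_in_free_group[of "inv_word w" n] by (simp add: uminus_free_grp.abs_eq)
qed

lemma diff_in_free_group [simp]:
  "v \<in> carrier (free_group n) \<Longrightarrow> w \<in> carrier (free_group n) \<Longrightarrow> v - w \<in> carrier (free_group n)"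
  by (metis add_in_free_group uminus_in_free_group diff_conv_add_uminus)

lemma group_free_group: "group (free_group n)"
proof (rule groupI)
  fix x assume "x \<in> carrier (free_group n)"
  then show "\<exists>y\<in>carrier (free_group n). y \<otimes>\<^bsub>free_group n\<^esub> x = \<one>\<^bsub>free_group n\<^esub>"
    by (intro bexI[of _ "- x"]) simp_all
qed (simp_all add: add.assoc)

lemma inv_free_group: "v \<in> carrier (free_group n) \<Longrightarrow> inv\<^bsub>free_group n\<^esub> v = - v"
  using group.inv_equality[OF group_free_group, where x = v and y = "- v"] by simp

lemma free_group_induct [consumes 1, case_names zero gen neg]:
  assumes "g \<in> carrier (free_group n)" and "P 0"
    and "\<And>a w. a < n \<Longrightarrow> w \<in> carrier (free_group n) \<Longrightarrow> P w \<Longrightarrow> P (gen a + w)"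
    and "\<And>a w. a < n \<Longrightarrow> w \<in> carrier (free_group n) \<Longrightarrow> P w \<Longrightarrow> P (- gen a + w)"
  shows "P g"
proof -
  obtain w where w: "g = abs_free_grp w" "fst ` set w \<subseteq> {..<n}"
    using assms(1) by (rule free_group_cases)
  from w(2) have "P (abs_free_grp w)"
    by (induction w)
      (auto simp: abs_free_grp_Cons letter_def assms intro!: assms(3,4) abs_free_grp_in_free_group)
  with w show ?thesis
    by simp
qed

lemma generate_free_group: "generate (free_group n) (gen ` {..<n}) = carrier (free_group n)"
proof
  show "generate (free_group n) (gen ` {..<n}) \<subseteq> carrier (free_group n)"
    by (rule group.generate_incl[OF group_free_group]) auto
  show "carrier (free_group n) \<subseteq> generate (free_group n) (gen ` {..<n})" (is "_ \<subseteq> ?G")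
  proof
    fix g assume "g \<in> carrier (free_group n)"
    then show "g \<in> ?G"
    proof (induction rule: free_group_induct)
      case zero
      then show ?case
        using generate.one[of "free_group n"] by simp
    next
      case (gen a w)
      then show ?case
        using generate.eng[OF generate.incl[of "gen a" "gen ` {..<n}" "free_group n"], of w] by simp
    next
      case (neg a w)
      then show ?case
        using generate.eng[OF generate.inv[of "gen a" "gen ` {..<n}" "free_group n"], of w]
        by (simp add: inv_free_group)
    qed
  qed
qed

lemma free_lift_zero [simp]: "free_lift f 0 = 0"
  by transfer simp

lemma free_lift_uminus [simp]: "free_lift f (- v) = - free_lift f v"
proof -
  have "free_lift f (- v) + free_lift f v = 0"
    by (simp flip: free_lift_add)
  then show ?thesis
    by (simp add: eq_neg_iff_add_eq_0)
qed

lemma free_lift_diff [simp]: "free_lift f (v - w) = free_lift f v - free_lift f w"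
  by (metis free_lift_add free_lift_uminus diff_conv_add_uminus)

lemmas free_lift_simps [simp] = free_lift_gen free_lift_add

lemma free_lift_in_free_group:
  assumes "\<And>a. a < m \<Longrightarrow> f a \<in> carrier (free_group n)" "v \<in> carrier (free_group m)"
  shows "free_lift f v \<in> carrier (free_group n)"
  using assms(2) by (induction rule: free_group_induct) (simp_all add: assms(1))

text \<open>
  Both the uniqueness of the representation and that of the braid group embedding reduce to
  this.
\<close>

lemma hom_eq_on_generate:
  assumes "group G" "group H" "h \<in> hom G H" "k \<in> hom G H" "S \<subseteq> carrier G"
    and "\<And>x. x \<in> S \<Longrightarrow> h x = k x" and "x \<in> generate G S"
  shows "h x = k x"
proof -
  interpret h: group_hom G H h
    using assms by (simp add: group_hom_def group_hom_axioms_def)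
  interpret k: group_hom G H k
    using assms by (simp add: group_hom_def group_hom_axioms_def)
  note mem = h.G.generate_in_carrier[OF assms(5)]
  from assms(7) show ?thesis
    by induction (use assms(5,6) mem in \<open>auto simp: subset_iff\<close>)
qed

section \<open>Reduced words\<close>

definition reduced :: "('a \<times> bool) list \<Rightarrow> bool" where
  "reduced = successively (\<lambda>x y. y \<noteq> flip x)"

fun rcons :: "'a \<times> bool \<Rightarrow> ('a \<times> bool) list \<Rightarrow> ('a \<times> bool) list" where
  "rcons x [] = [x]"
| "rcons x (y # w) = (if y = flip x then w else x # y # w)"

text \<open>
  Multiplication by a letter acts on reduced words by \<open>rcons\<close>, a letter and its inverse acting by
  inverse maps; a normal form is the image of the empty word under this action.
\<close>

definition normal_form :: "('a \<times> bool) list \<Rightarrow> ('a \<times> bool) list" where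
  "normal_form w = foldr rcons w []"

lemma normal_form_simps [simp]:
  "normal_form [] = []" "normal_form (x # w) = rcons x (normal_form w)"
  by (simp_all add: normal_form_def)

lemma reduced_Nil [simp]: "reduced []"
  and reduced_Cons: "reduced (x # w) \<longleftrightarrow> w = [] \<or> hd w \<noteq> flip x \<and> reduced w"
  and reduced_append: "reduced (u @ v) \<longleftrightarrow>
    reduced u \<and> reduced v \<and> (u = [] \<or> v = [] \<or> hd v \<noteq> flip (last u))"
  by (auto simp: reduced_def successively_Cons successively_append_iff)

lemma reduced_rcons: "reduced w \<Longrightarrow> reduced (rcons x w)"
  by (cases w) (auto simp: reduced_Cons)

lemma reduced_normal_form: "reduced (normal_form w)"
  by (induction w) (simp_all add: reduced_rcons)

lemma rcons_flip: "reduced w \<Longrightarrow> rcons x (rcons (flip x) w) = w"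
  by (cases w; cases "tl w") (auto simp: reduced_Cons)

lemma set_normal_form: "set (normal_form w) \<subseteq> set w"
proof (induction w)
  case (Cons x w)
  have "set (rcons x (normal_form w)) \<subseteq> insert x (set (normal_form w))"
    by (cases "normal_form w") auto
  with Cons show ?case
    by auto
qed simp

lemma normal_form_reduced: "reduced w \<Longrightarrow> normal_form w = w"
proof (induction w)
  case (Cons x w)
  then show ?case
    by (cases w) (simp_all add: reduced_Cons)
qed simp

lemma abs_free_grp_rcons: "abs_free_grp (rcons x w) = letter x + abs_free_grp w"
  by (cases w) (auto simp: abs_free_grp_Cons simp flip: add.assoc)

lemma abs_free_grp_normal_form: "abs_free_grp (normal_form w) = abs_free_grp w"
  by (induction w) (simp_all add: abs_free_grp_rcons abs_free_grp_Cons)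

lemma normal_form_append: "normal_form (u @ v) = foldr rcons u (normal_form v)"
  by (simp add: normal_form_def)

lemma normal_form_cong: "free_eq u v \<Longrightarrow> normal_form u = normal_form v"
proof (erule free_eq_induct)
  fix u v :: "('a \<times> bool) list" assume "cancels u v"
  then obtain p a b q where "u = p @ [(a, b), (a, \<not> b)] @ q" "v = p @ q"
    by (auto elim: cancels.cases)
  then show "normal_form u = normal_form v"
    using rcons_flip[OF reduced_normal_form[of q], of "(a, b)"]
    by (simp add: normal_form_append flip_def)
qed auto

text \<open>
  The normal form depends only on the group element, by \<open>normal_form_cong\<close>, and a reduced word is
  its own normal form.
\<close>

lemma reduced_unique:
  assumes "abs_free_grp u = abs_free_grp v" "reduced u" "reduced v"
  shows "u = v"
  using assms by (metis abs_free_grp_eq_iff normal_form_cong normal_form_reduced)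

section \<open>Linear maps on the group ring\<close>

definition linear_extension :: "('g \<Rightarrow> 'r::ring_1) \<Rightarrow> ('g \<Rightarrow>\<^sub>0 int) \<Rightarrow> 'r" where
  "linear_extension f p = (\<Sum>g\<in>Poly_Mapping.keys p. of_int (Poly_Mapping.lookup p g) * f g)"

lemma linear_extension_single: "linear_extension f (Poly_Mapping.single g 1) = f g"
  by (simp add: linear_extension_def)

lemma linear_extension_superset:
  assumes "finite A" "Poly_Mapping.keys p \<subseteq> A"
  shows "linear_extension f p = (\<Sum>g\<in>A. of_int (Poly_Mapping.lookup p g) * f g)"
  unfolding linear_extension_def
  by (rule sum.mono_neutral_left) (use assms in \<open>auto simp: in_keys_iff\<close>)

lemma linear_extension_add: "linear_extension f (p + q) = linear_extension f p + linear_extension f q"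
proof -
  define A where "A = Poly_Mapping.keys p \<union> Poly_Mapping.keys q"
  have A: "finite A" "Poly_Mapping.keys p \<subseteq> A" "Poly_Mapping.keys q \<subseteq> A"
    "Poly_Mapping.keys (p + q) \<subseteq> A"
    using keys_add[of p q] by (auto simp: A_def)
  show ?thesis
    by (simp add: linear_extension_superset[OF A(1)] A lookup_add algebra_simps sum.distrib)
qed

lemma additive_minus:
  fixes h :: "'a::ab_group_add \<Rightarrow> 'b::ab_group_add"
  assumes "\<And>p q. h (p + q) = h p + h q"
  shows "h (p - q) = h p - h q"
  by (metis add_diff_cancel_right' assms diff_add_cancel)

lemma additive_zero:
  fixes h :: "'a::ab_group_add \<Rightarrow> 'b::ab_group_add"
  assumes "\<And>p q. h (p + q) = h p + h q"
  shows "h 0 = 0"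
  using additive_minus[of h 0 0, OF assms] by simp

lemma group_ring_induct [case_names zero single diff]:
  assumes "P 0" and "\<And>g. P (Poly_Mapping.single g 1)" and "\<And>p q. P p \<Longrightarrow> P q \<Longrightarrow> P (p - q)"
  shows "P (p :: 'g \<Rightarrow>\<^sub>0 int)"
  by (rule frag_induction[of p UNIV P]) (use assms in auto)

lemma additive_eqI:
  fixes h k :: "('g \<Rightarrow>\<^sub>0 int) \<Rightarrow> 'b::ab_group_add"
  assumes "\<And>p q. h (p + q) = h p + h q" "\<And>p q. k (p + q) = k p + k q"
    and "\<And>g. h (Poly_Mapping.single g 1) = k (Poly_Mapping.single g 1)"
  shows "h p = k p"
  by (induction p rule: group_ring_induct)
    (simp_all add: additive_zero[of h] additive_zero[of k] additive_minus[of h] additive_minus[of k] assms)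

lemma augmentation_conv_linear_extension: "augmentation = linear_extension (\<lambda>_. 1)"
  by (simp add: fun_eq_iff augmentation_def linear_extension_def)

lemma psi_conv_linear_extension: "psi = linear_extension (\<lambda>g. tpow (free_lift (\<lambda>_. 1) g))"
  by (simp add: fun_eq_iff psi_def linear_extension_def)

lemma tpow_add: "tpow (a + b) = tpow a * tpow b"
  by (simp add: tpow_def mult_single)

lemma tpow_0 [simp]: "tpow 0 = 1"
  by (simp add: tpow_def)

text \<open>By biadditivity it is enough to compare both sides on group elements.\<close>

lemma linear_extension_mult:
  fixes f :: "'g::monoid_add \<Rightarrow> 'r::ring_1"
  assumes "\<And>g h. f (g + h) = f g * f h"
  shows "linear_extension f (p * q) = linear_extension f p * linear_extension f q"
proof -
  note additive = linear_extension_add[of f]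
  have single: "linear_extension f (Poly_Mapping.single g 1 * q) = f g * linear_extension f q" for g
    by (rule additive_eqI[where p = q])
      (simp_all add: distrib_left additive mult_single linear_extension_single assms)
  show ?thesis
    by (rule additive_eqI[where p = p])
      (simp_all add: distrib_right additive single linear_extension_single)
qed

lemma augmentation_add: "augmentation (p + q) = augmentation p + augmentation q"
  and augmentation_mult: "augmentation (p * q) = augmentation p * augmentation q"
  and augmentation_single [simp]: "augmentation (Poly_Mapping.single g 1) = 1"
  by (simp_all add: augmentation_conv_linear_extension linear_extension_add linear_extension_mult
      linear_extension_single)

lemma psi_add: "psi (p + q) = psi p + psi q"
  and psi_mult: "psi (p * q) = psi p * psi q"
  and psi_single: "psi (Poly_Mapping.single g 1) = tpow (free_lift (\<lambda>_. 1) g)"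
  by (simp_all add: psi_conv_linear_extension linear_extension_add linear_extension_mult
      linear_extension_single tpow_add)

section \<open>Fox derivatives\<close>

text \<open>
  The recursion is forced by the product rule, because a single word has augmentation one, and by
  the value \<open>- x\<^sup>-\<^sup>1\<close> of the derivative of an inverse generator \<open>x\<^sup>-\<^sup>1\<close>.
\<close>

fun fox_word :: "'a \<Rightarrow> ('a \<times> bool) list \<Rightarrow> ('a free_grp \<Rightarrow>\<^sub>0 int)" where
  "fox_word j [] = 0"
| "fox_word j (x # w) =
    (if fst x = j then (if snd x then - Poly_Mapping.single (letter x) 1 else 1) else 0)
    + Poly_Mapping.single (letter x) 1 * fox_word j w"

lemma fox_word_append:
  "fox_word j (u @ v) = fox_word j u + Poly_Mapping.single (abs_free_grp u) 1 * fox_word j v"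
proof (induction u)
  case (Cons x u)
  have "Poly_Mapping.single (letter x + abs_free_grp u) 1
    = Poly_Mapping.single (letter x) 1 * Poly_Mapping.single (abs_free_grp u) (1::int)"
    by (simp add: mult_single)
  with Cons show ?case
    by (simp add: abs_free_grp_Cons algebra_simps)
qed simp

lemma fox_word_cong: "free_eq u v \<Longrightarrow> fox_word j u = fox_word j v"
proof (erule free_eq_induct)
  fix u v :: "('a \<times> bool) list" assume "cancels u v"
  then obtain p a b q where "u = p @ [(a, b), (a, \<not> b)] @ q" "v = p @ q"
    by (auto elim: cancels.cases)
  moreover have "fox_word j ([(a, b), (a, \<not> b)] @ q) = fox_word j q"
    by (simp add: letter_def algebra_simps mult_single flip: mult.assoc)
  ultimately show "fox_word j u = fox_word j v"
    by (simp only: fox_word_append)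
qed auto

definition fox_element :: "'a \<Rightarrow> 'a free_grp \<Rightarrow> ('a free_grp \<Rightarrow>\<^sub>0 int)" where
  "fox_element j g = fox_word j (rep_free_grp g)"

lemma fox_element_abs: "fox_element j (abs_free_grp w) = fox_word j w"
  unfolding fox_element_def
  by (rule fox_word_cong) (metis abs_free_grp_eq_iff Quotient3_abs_rep Quotient3_free_grp)

lemma fox_element_add:
  "fox_element j (v + w) = fox_element j v + Poly_Mapping.single v 1 * fox_element j w"
proof -
  obtain v' w' where "v = abs_free_grp v'" "w = abs_free_grp w'"
    by (metis abs_free_grp_cases)
  then show ?thesis
    by (simp add: fox_element_abs fox_word_append flip: abs_free_grp_append)
qed

lemma fox_element_gen: "fox_element j (gen i) = (if i = j then 1 else 0)"
  using fox_element_abs[of j "[(i, False)]"] by (simp add: abs_free_grp_singleton)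

lemma fox_derivation_linear_extension: "fox_derivation j (linear_extension (fox_element j))"
  (is "fox_derivation j ?D")
  unfolding fox_derivation_def
proof (intro conjI allI)
  note additive = linear_extension_add[of "fox_element j"] augmentation_add
  have single: "?D (Poly_Mapping.single g 1 * q) =
    ?D (Poly_Mapping.single g 1) * of_int (augmentation q) + Poly_Mapping.single g 1 * ?D q" for g q
    by (rule additive_eqI[where p = q])
      (simp_all add: algebra_simps additive mult_single linear_extension_single fox_element_add)
  show "?D (p * q) = ?D p * of_int (augmentation q) + p * ?D q" for p q
    by (rule additive_eqI[where p = p]) (simp_all add: single additive algebra_simps)
qed (simp_all add: linear_extension_add linear_extension_single fox_element_gen)

text \<open>
  The product rule with the second factor a group element determines a derivation on words letter
  by letter; applied to \<open>- gen a + gen a = 0\<close> it gives the value on inverse generators.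
\<close>

lemma fox_derivation_unique:
  assumes "fox_derivation j D"
  shows "D = linear_extension (fox_element j)" 
proof
  fix p
  have add: "D (p + q) = D p + D q" for p q
    using assms by (simp add: fox_derivation_def)
  have mult: "D (Poly_Mapping.single (v + w) 1) =
      D (Poly_Mapping.single v 1) + Poly_Mapping.single v 1 * D (Poly_Mapping.single w 1)" for v w
  proof -
    have "D (Poly_Mapping.single v 1 * Poly_Mapping.single w 1) =
      D (Poly_Mapping.single v 1) * of_int (augmentation (Poly_Mapping.single w 1))
      + Poly_Mapping.single v 1 * D (Poly_Mapping.single w 1)"
      using assms by (simp only: fox_derivation_def)
    then show ?thesis
      by (simp add: mult_single)
  qed
  have gen: "D (Poly_Mapping.single (gen a) 1) = fox_element j (gen a)" for a
    using assms by (simp add: fox_derivation_def fox_element_gen)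
  have zero: "D (Poly_Mapping.single 0 1) = 0" "fox_element j 0 = 0"
    using mult[of 0 0] fox_element_add[of j 0 0] by simp_all
  have neg: "D (Poly_Mapping.single (- gen a) 1) = fox_element j (- gen a)" for a
  proof -
    have "D (Poly_Mapping.single (- gen a) 1) = - (Poly_Mapping.single (- gen a) 1 * fox_element j (gen a))"
      using mult[of "- gen a" "gen a"] zero by (simp add: gen eq_neg_iff_add_eq_0)
    moreover have "fox_element j (- gen a) = - (Poly_Mapping.single (- gen a) 1 * fox_element j (gen a))"
      using fox_element_add[of j "- gen a" "gen a"] zero by (simp add: eq_neg_iff_add_eq_0)
    ultimately show ?thesis
      by simp
  qed
  have single: "D (Poly_Mapping.single g 1) = fox_element j g" for g
    by (induction g rule: free_grp_induct) (simp_all only: zero mult fox_element_add gen neg)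
  show "D p = linear_extension (fox_element j) p"
    by (rule additive_eqI[where p = p and h = D]) (simp_all add: add single linear_extension_add linear_extension_single)
qed

lemma fox_conv_linear_extension: "fox j = linear_extension (fox_element j)"
  unfolding fox_def
  using fox_derivation_linear_extension fox_derivation_unique by (rule the_equality)

definition degree :: "'a free_grp \<Rightarrow> int" where
  "degree = free_lift (\<lambda>_. 1)"

lemma degree_simps [simp]:
  "degree 0 = 0" "degree (gen a) = 1" "degree (v + w) = degree v + degree w" "degree (- v) = - degree v"
  by (simp_all add: degree_def)

text \<open>
  As a function of the group element, the specialised derivative is a crossed homomorphism into
  \<open>\<int>[t, t\<^sup>-\<^sup>1]\<close>, on which \<open>v\<close> acts by \<open>t\<close> to the power of its degree. Only this is used from here on.
\<close>

definition fox_laurent :: "'a \<Rightarrow> 'a free_grp \<Rightarrow> laurent" where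
  "fox_laurent j v = psi (fox j (Poly_Mapping.single v 1))"

lemma fox_laurent_add: "fox_laurent j (v + w) = fox_laurent j v + tpow (degree v) * fox_laurent j w"
  by (simp add: fox_laurent_def fox_conv_linear_extension linear_extension_single fox_element_add
      psi_add psi_mult psi_single degree_def)

lemma fox_laurent_gen: "fox_laurent j (gen i) = (if i = j then 1 else 0)"
  for j :: 'a
  using psi_single[of "0 :: 'a free_grp"] additive_zero[of "psi :: ('a free_grp \<Rightarrow>\<^sub>0 int) \<Rightarrow> laurent", OF psi_add]
  by (simp add: fox_laurent_def fox_conv_linear_extension linear_extension_single fox_element_gen)

lemma fox_laurent_zero [simp]: "fox_laurent j 0 = 0"
  using fox_laurent_add[of j 0 0] by simp

lemma fox_laurent_uminus: "fox_laurent j (- v) = - tpow (- degree v) * fox_laurent j v"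
  using fox_laurent_add[of j "- v" v] by (simp add: eq_neg_iff_add_eq_0)

text \<open>
  For \<open>v = gen i\<close> and \<open>f = gen j\<close> the right-hand side is the nontrivial row of \<open>eps_mat\<close>.
\<close>

lemma fox_laurent_conjugate:
  "fox_laurent j (- f + v + f) = tpow (- degree f) * (fox_laurent j v + (tpow (degree v) - 1) * fox_laurent j f)"
proof -
  have "fox_laurent j (- f + v + f) = - tpow (- degree f) * fox_laurent j f
      + tpow (- degree f) * fox_laurent j v + tpow (- degree f) * tpow (degree v) * fox_laurent j f"
    by (simp only: fox_laurent_add fox_laurent_uminus degree_simps tpow_add)
  also have "\<dots> = tpow (- degree f) * (fox_laurent j v + (tpow (degree v) - 1) * fox_laurent j f)"
    by (simp only: distrib_left left_diff_distrib right_diff_distrib mult.assoc mult_1_left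
        mult_minus_left) simp
  finally show ?thesis .
qed

section \<open>Endomorphisms and automorphisms of the free group\<close>

lemma mult_aut_group: "\<alpha> \<otimes>\<^bsub>aut_group n\<^esub> \<beta> = compose (carrier (free_group n)) \<beta> \<alpha>"
  and mult_conj_aut_group: "\<alpha> \<otimes>\<^bsub>conj_aut_group n\<^esub> \<beta> = compose (carrier (free_group n)) \<beta> \<alpha>"
  and one_aut_group: "\<one>\<^bsub>aut_group n\<^esub> = (\<lambda>w\<in>carrier (free_group n). w)"
  and one_conj_aut_group: "\<one>\<^bsub>conj_aut_group n\<^esub> = (\<lambda>w\<in>carrier (free_group n). w)"
  and carrier_aut_group: "carrier (aut_group n) = auto (free_group n)"
  by (simp_all add: aut_group_def conj_aut_group_def)

lemma hom_free_group_closed: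
  "\<alpha> \<in> hom (free_group n) (free_group n) \<Longrightarrow> v \<in> carrier (free_group n) \<Longrightarrow> \<alpha> v \<in> carrier (free_group n)"
  and hom_free_group_add:
  "\<alpha> \<in> hom (free_group n) (free_group n) \<Longrightarrow> v \<in> carrier (free_group n) \<Longrightarrow>
    w \<in> carrier (free_group n) \<Longrightarrow> \<alpha> (v + w) = \<alpha> v + \<alpha> w"
  using hom_mult[of \<alpha> "free_group n" "free_group n" v w]
  by (auto simp: hom_in_carrier)

lemma hom_free_group_zero: "\<alpha> \<in> hom (free_group n) (free_group n) \<Longrightarrow> \<alpha> 0 = 0"
  using hom_free_group_add[of \<alpha> n 0 0] by (metis add.right_neutral add_left_cancel zero_in_free_group)

lemma hom_free_group_uminus:
  "\<alpha> \<in> hom (free_group n) (free_group n) \<Longrightarrow> v \<in> carrier (free_group n) \<Longrightarrow> \<alpha> (- v) = - \<alpha> v"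
  using hom_free_group_add[of \<alpha> n "- v" v] by (simp add: hom_free_group_zero eq_neg_iff_add_eq_0)

lemmas hom_free_group_simps =
  hom_free_group_closed hom_free_group_add hom_free_group_zero hom_free_group_uminus

lemma auto_eqI:
  assumes "\<alpha> \<in> hom (free_group n) (free_group n)" "\<beta> \<in> hom (free_group n) (free_group n)"
    and "\<alpha> \<in> extensional (carrier (free_group n))" "\<beta> \<in> extensional (carrier (free_group n))"
    and "\<And>i. i < n \<Longrightarrow> \<alpha> (gen i) = \<beta> (gen i)"
  shows "\<alpha> = \<beta>"
proof (rule extensionalityI[OF assms(3,4)])
  fix w assume "w \<in> carrier (free_group n)"
  then show "\<alpha> w = \<beta> w"
    by (induction rule: free_group_induct) (simp_all add: hom_free_group_simps[OF assms(1)] hom_free_group_simps[OF assms(2)] assms(5))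
qed

lemma endo_apply: "w \<in> carrier (free_group n) \<Longrightarrow> endo n f w = free_lift f w"
  by (simp add: endo_def)

lemma endo_hom:
  assumes "\<And>i. i < n \<Longrightarrow> f i \<in> carrier (free_group n)"
  shows "endo n f \<in> hom (free_group n) (free_group n)"
  using assms by (auto intro!: homI simp: endo_apply free_lift_in_free_group[where m = n])

text \<open>The endomorphism given by \<open>g\<close> serves as the inverse.\<close>

lemma endo_auto:
  assumes f: "\<And>i. i < n \<Longrightarrow> f i \<in> carrier (free_group n)"
    and g: "\<And>i. i < n \<Longrightarrow> g i \<in> carrier (free_group n)"
    and fg: "\<And>i. i < n \<Longrightarrow> free_lift f (g i) = gen i"
    and gf: "\<And>i. i < n \<Longrightarrow> free_lift g (f i) = gen i"
  shows "endo n f \<in> auto (free_group n)"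
proof -
  have "free_lift f (free_lift g w) = w" "free_lift g (free_lift f w) = w"
    if "w \<in> carrier (free_group n)" for w
    using that by (induction rule: free_group_induct) (simp_all add: fg gf)
  then have "bij_betw (endo n f) (carrier (free_group n)) (carrier (free_group n))"
    using f g by (intro bij_betw_byWitness[where f' = "endo n g"])
      (auto simp: endo_apply free_lift_in_free_group[where m = n])
  then show ?thesis
    using endo_hom[OF f] by (simp add: auto_def Bij_def endo_def)
qed

lemma group_aut_group: "group (aut_group n)"
proof (rule groupI, unfold carrier_aut_group mult_aut_group one_aut_group)
  let ?F = "free_group n"
  interpret F: group ?F
    by (rule group_free_group)
  show "(\<lambda>w\<in>carrier ?F. w) \<in> auto ?F"
    by (rule F.id_in_auto)
  fix \<alpha> assume \<alpha>: "\<alpha> \<in> auto ?F"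
  then show "compose (carrier ?F) \<alpha> (\<lambda>w\<in>carrier ?F. w) = \<alpha>"
    by (auto simp: auto_def intro!: compose_Id Bij_imp_funcset Bij_imp_extensional)
  let ?\<beta> = "\<lambda>w\<in>carrier ?F. inv_into (carrier ?F) \<alpha> w"
  have "?\<beta> \<in> auto ?F"
    using \<alpha> F.restrict_inv_into_hom restrict_inv_into_Bij by (auto simp: auto_def)
  moreover have "compose (carrier ?F) \<alpha> ?\<beta> = (\<lambda>w\<in>carrier ?F. w)"
    using \<alpha> by (intro compose_id_inv_into) (auto simp: auto_def Bij_def bij_betw_def)
  ultimately show "\<exists>\<beta>\<in>auto ?F. compose (carrier ?F) \<alpha> \<beta> = (\<lambda>w\<in>carrier ?F. w)"
    by blast
next
  fix \<alpha> \<beta> assume "\<alpha> \<in> auto (free_group n)" "\<beta> \<in> auto (free_group n)"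
  then show "compose (carrier (free_group n)) \<beta> \<alpha> \<in> auto (free_group n)"
    by (auto simp: auto_def compose_Bij group.hom_compose[OF group_free_group])
next
  fix \<alpha> \<beta> \<gamma> assume "\<alpha> \<in> auto (free_group n)"
  then show "compose (carrier (free_group n)) \<gamma> (compose (carrier (free_group n)) \<beta> \<alpha>) =
      compose (carrier (free_group n)) (compose (carrier (free_group n)) \<gamma> \<beta>) \<alpha>"
    by (intro compose_assoc) (simp add: auto_def Bij_imp_funcset)
qed

section \<open>The group of conjugating automorphisms\<close>

lemma conj_autE:
  assumes "\<alpha> \<in> carrier (conj_aut_group n)"
  obtains \<pi> f where "\<alpha> \<in> auto (free_group n)" "\<pi> permutes {..<n}"
    "\<And>i. i < n \<Longrightarrow> f i \<in> carrier (free_group n)"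
    "\<And>i. i < n \<Longrightarrow> \<alpha> (gen i) = - f i + gen (\<pi> i) + f i"
proof -
  obtain \<pi> where "\<alpha> \<in> auto (free_group n)" "\<pi> permutes {..<n}"
    "\<forall>i<n. \<exists>f\<in>carrier (free_group n). \<alpha> (gen i) = - f + gen (\<pi> i) + f"
    using assms by (auto simp: conj_aut_group_def carrier_aut_group)
  then show thesis
    using that by metis
qed

lemma conj_autI:
  assumes "\<alpha> \<in> auto (free_group n)" "\<pi> permutes {..<n}"
    and "\<And>i. i < n \<Longrightarrow> f i \<in> carrier (free_group n)"
    and "\<And>i. i < n \<Longrightarrow> \<alpha> (gen i) = - f i + gen (\<pi> i) + f i"
  shows "\<alpha> \<in> carrier (conj_aut_group n)"
  using assms by (auto simp: conj_aut_group_def carrier_aut_group)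

lemma auto_imp_hom: "\<alpha> \<in> auto (free_group n) \<Longrightarrow> \<alpha> \<in> hom (free_group n) (free_group n)"
  and auto_imp_extensional: "\<alpha> \<in> auto (free_group n) \<Longrightarrow> \<alpha> \<in> extensional (carrier (free_group n))"
  by (auto simp: auto_def Bij_def)

lemma conj_aut_imp_auto: "\<alpha> \<in> carrier (conj_aut_group n) \<Longrightarrow> \<alpha> \<in> auto (free_group n)"
  by (erule conj_autE)

lemmas conj_aut_imp_hom = conj_aut_imp_auto[THEN auto_imp_hom]
  and conj_aut_imp_extensional = conj_aut_imp_auto[THEN auto_imp_extensional]

lemma conj_aut_eqI:
  assumes "\<alpha> \<in> carrier (conj_aut_group n)" "\<beta> \<in> carrier (conj_aut_group n)"
    and "\<And>i. i < n \<Longrightarrow> \<alpha> (gen i) = \<beta> (gen i)"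
  shows "\<alpha> = \<beta>"
  using assms by (intro auto_eqI[where n = n]) (auto simp: conj_aut_imp_hom conj_aut_imp_extensional)

text \<open>
  If \<open>\<alpha>\<close> sends \<open>gen i\<close> to \<open>- f i + gen (\<pi> i) + f i\<close>, then applying the inverse \<open>\<beta>\<close> to this equation
  and solving for \<open>\<beta> (gen (\<pi> i))\<close> exhibits it as a conjugate of \<open>gen i\<close> by \<open>- \<beta> (f i)\<close>.
\<close>

lemma group_conj_aut_group: "group (conj_aut_group n)"
proof -
  interpret A: group "aut_group n"
    by (rule group_aut_group)
  let ?F = "carrier (free_group n)"
  have "subgroup (carrier (conj_aut_group n)) (aut_group n)"
  proof (rule A.subgroupI)
    show "carrier (conj_aut_group n) \<subseteq> carrier (aut_group n)"
      by (auto simp: carrier_aut_group conj_aut_imp_auto)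
    have "\<one>\<^bsub>aut_group n\<^esub> \<in> carrier (conj_aut_group n)"
      using A.one_closed
      by (intro conj_autI[where \<pi> = id and f = "\<lambda>_. 0"])
        (auto simp: carrier_aut_group one_aut_group permutes_id)
    then show "carrier (conj_aut_group n) \<noteq> {}"
      by blast
  next
    fix \<alpha> assume \<alpha>: "\<alpha> \<in> carrier (conj_aut_group n)"
    then obtain \<pi> f where \<pi>: "\<pi> permutes {..<n}"
      and f: "\<And>i. i < n \<Longrightarrow> f i \<in> ?F" "\<And>i. i < n \<Longrightarrow> \<alpha> (gen i) = - f i + gen (\<pi> i) + f i"
      by (metis conj_autE)
    define \<beta> where "\<beta> = inv\<^bsub>aut_group n\<^esub> \<alpha>"
    have "\<alpha> \<in> carrier (aut_group n)"
      using \<alpha> by (simp add: carrier_aut_group conj_aut_imp_auto)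
    then have \<beta>: "\<beta> \<in> auto (free_group n)" "compose ?F \<beta> \<alpha> = (\<lambda>w\<in>?F. w)"
      using A.inv_closed A.r_inv unfolding \<beta>_def by (simp_all add: carrier_aut_group mult_aut_group one_aut_group)
    have hom: "\<beta> \<in> hom (free_group n) (free_group n)"
      using \<beta>(1) by (rule auto_imp_hom)
    note \<pi>_simps = permutes_in_image[OF \<pi>] permutes_in_image[OF permutes_inv[OF \<pi>]] permutes_inverses[OF \<pi>]
    show "\<beta> \<in> carrier (conj_aut_group n)"
    proof (rule conj_autI[where \<pi> = "inv_into UNIV \<pi>" and f = "\<lambda>k. - \<beta> (f (inv_into UNIV \<pi> k))"])
      fix k assume "k < n"
      define i where "i = inv_into UNIV \<pi> k"
      have i: "i < n" "\<pi> i = k"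
        using \<open>k < n\<close> \<pi>_simps by (auto simp: i_def)
      have "\<beta> (\<alpha> (gen i)) = gen i"
        using fun_cong[OF \<beta>(2), of "gen i"] i by (simp add: compose_def)
      then have "- \<beta> (f i) + \<beta> (gen k) + \<beta> (f i) = gen i"
        using f[OF i(1)] i \<open>k < n\<close> by (simp add: hom_free_group_simps[OF hom])
      moreover have "\<beta> (f i) + (- \<beta> (f i) + \<beta> (gen k) + \<beta> (f i)) - \<beta> (f i) = \<beta> (gen k)"
        by (simp add: add.assoc)
      ultimately have "\<beta> (gen k) = \<beta> (f i) + gen i - \<beta> (f i)"
        by simp
      then show "\<beta> (gen k) = - (- \<beta> (f (inv_into UNIV \<pi> k))) + gen (inv_into UNIV \<pi> k) + - \<beta> (f (inv_into UNIV \<pi> k))"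
        by (simp add: i_def)
      show "- \<beta> (f (inv_into UNIV \<pi> k)) \<in> ?F"
        using f(1)[OF i(1)] by (simp add: i_def hom_free_group_simps[OF hom])
    qed (simp_all add: \<beta> permutes_inv[OF \<pi>])
  next
    fix \<alpha> \<beta> assume \<alpha>: "\<alpha> \<in> carrier (conj_aut_group n)" and \<beta>: "\<beta> \<in> carrier (conj_aut_group n)"
    from \<alpha> obtain \<pi> f where \<pi>: "\<pi> permutes {..<n}"
      and f: "\<And>i. i < n \<Longrightarrow> f i \<in> ?F" "\<And>i. i < n \<Longrightarrow> \<alpha> (gen i) = - f i + gen (\<pi> i) + f i"
      by (metis conj_autE)
    from \<beta> obtain \<sigma> g where \<sigma>: "\<sigma> permutes {..<n}"
      and g: "\<And>i. i < n \<Longrightarrow> g i \<in> ?F" "\<And>i. i < n \<Longrightarrow> \<beta> (gen i) = - g i + gen (\<sigma> i) + g i"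
      by (metis conj_autE)
    have \<pi>_lt: "\<pi> i < n" if "i < n" for i
      using permutes_in_image[OF \<pi>] that by auto
    note hom = conj_aut_imp_hom[OF \<beta>]
    show "\<alpha> \<otimes>\<^bsub>aut_group n\<^esub> \<beta> \<in> carrier (conj_aut_group n)"
    proof (rule conj_autI[where \<pi> = "\<sigma> \<circ> \<pi>" and f = "\<lambda>i. g (\<pi> i) + \<beta> (f i)"])
      show "\<alpha> \<otimes>\<^bsub>aut_group n\<^esub> \<beta> \<in> auto (free_group n)"
        using A.m_closed[of \<alpha> \<beta>] \<alpha> \<beta> by (simp add: carrier_aut_group conj_aut_imp_auto)
      fix i assume "i < n"
      then show "(\<alpha> \<otimes>\<^bsub>aut_group n\<^esub> \<beta>) (gen i) =
          - (g (\<pi> i) + \<beta> (f i)) + gen ((\<sigma> \<circ> \<pi>) i) + (g (\<pi> i) + \<beta> (f i))"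
        by (simp add: mult_aut_group compose_def f g \<pi>_lt hom_free_group_simps[OF hom] minus_add add.assoc
            del: add_uminus_conv_diff)
      show "g (\<pi> i) + \<beta> (f i) \<in> ?F"
        using \<open>i < n\<close> by (simp add: f g \<pi>_lt hom_free_group_simps[OF hom])
    qed (rule permutes_compose[OF \<pi> \<sigma>])
  qed
  then show ?thesis
    using subgroup.subgroup_is_group[OF _ group_aut_group, of "carrier (conj_aut_group n)" n]
    by (simp add: conj_aut_group_def)
qed

lemma endo_gen: "i < n \<Longrightarrow> endo n f (gen i) = f i"
  by (simp add: endo_apply)

lemma eps_in_conj_aut_group:
  assumes "i < n" "j < n" "i \<noteq> j"
  shows "eps n i j \<in> carrier (conj_aut_group n)"
proof (rule conj_autI[where \<pi> = id and f = "\<lambda>l. if l = i then gen j else 0"])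
  show "eps n i j \<in> auto (free_group n)"
    unfolding eps_def
    by (rule endo_auto[where g = "\<lambda>l. if l = i then gen j + gen i + - gen j else gen l"])
      (use assms in \<open>auto simp: add.assoc\<close>)
qed (use assms in \<open>auto simp: eps_def endo_gen permutes_id\<close>)

lemma perm_aut_in_conj_aut_group:
  assumes "\<pi> permutes {..<n}"
  shows "perm_aut n \<pi> \<in> carrier (conj_aut_group n)"
proof (rule conj_autI[where \<pi> = \<pi> and f = "\<lambda>l. 0"])
  show "perm_aut n \<pi> \<in> auto (free_group n)"
    unfolding perm_aut_def
    by (rule endo_auto[where g = "\<lambda>l. gen (inv_into UNIV \<pi> l)"])
      (use permutes_in_image[OF assms] permutes_in_image[OF permutes_inv[OF assms]] in
        \<open>auto simp: permutes_inverses[OF assms]\<close>)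
qed (use assms in \<open>auto simp: perm_aut_def endo_gen\<close>)

lemma artin_aut_in_conj_aut_group:
  assumes "i + 1 < n"
  shows "artin_aut n i \<in> carrier (conj_aut_group n)"
proof (rule conj_autI[where \<pi> = "transpose i (i + 1)" and f = "\<lambda>l. if l = i then - gen i else 0"])
  show "artin_aut n i \<in> auto (free_group n)"
    unfolding artin_aut_def
    by (rule endo_auto[where g = "\<lambda>l. if l = i then gen (i + 1)
          else if l = i + 1 then - gen (i + 1) + gen i + gen (i + 1) else gen l"])
      (use assms in \<open>auto simp: add.assoc\<close>)
  show "transpose i (i + 1) permutes {..<n}"
    using assms by (intro permutes_swap_id) auto
qed (use assms in \<open>auto simp: artin_aut_def endo_gen transpose_def\<close>)

section \<open>The Jacobian representation\<close>

definition jacobian :: "nat \<Rightarrow> (nat free_grp \<Rightarrow> nat free_grp) \<Rightarrow> laurent mat" where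
  "jacobian n \<alpha> = mat n n (\<lambda>(i, j). fox_laurent j (\<alpha> (gen i)))"

lemma jacobian_carrier [simp]: "jacobian n \<alpha> \<in> carrier_mat n n"
  by (simp add: jacobian_def)

lemma degree_conj_aut:
  assumes "\<alpha> \<in> carrier (conj_aut_group n)" "w \<in> carrier (free_group n)"
  shows "degree (\<alpha> w) = degree w"
proof -
  note hom = conj_aut_imp_hom[OF assms(1)]
  have "degree (\<alpha> (gen a)) = 1" if "a < n" for a
    using assms(1) that by (auto elim!: conj_autE)
  with assms(2) show ?thesis
    by (induction rule: free_group_induct) (simp_all add: hom_free_group_simps[OF hom])
qed

text \<open>
  In the chain rule for Fox derivatives the derivatives of \<open>w\<close> are transported by \<open>\<alpha>\<close>. Since \<open>\<alpha>\<close>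
  preserves degrees, this transport is invisible after all generators have become \<open>t\<close>.
\<close>

lemma fox_laurent_chain:
  assumes "\<alpha> \<in> carrier (conj_aut_group n)" "w \<in> carrier (free_group n)"
  shows "fox_laurent j (\<alpha> w) = (\<Sum>k<n. fox_laurent k w * fox_laurent j (\<alpha> (gen k)))"
proof -
  note hom = conj_aut_imp_hom[OF assms(1)]
  have sum_gen: "(\<Sum>k<n. (if a = k then 1 else 0) * h k) = h a" if "a < n" for a and h :: "nat \<Rightarrow> laurent"
    using that by (simp add: if_distrib[of "\<lambda>x. x * _"] cong: if_cong)
  from assms(2) show ?thesis
  proof (induction rule: free_group_induct)
    case zero
    then show ?case
      by (simp add: hom_free_group_simps[OF hom])
  next
    case (gen a w)
    have "fox_laurent j (\<alpha> (gen a + w)) =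
        fox_laurent j (\<alpha> (gen a)) + tpow 1 * (\<Sum>k<n. fox_laurent k w * fox_laurent j (\<alpha> (gen k)))"
      using gen by (simp add: hom_free_group_simps[OF hom] fox_laurent_add degree_conj_aut[OF assms(1)])
    also have "\<dots> = (\<Sum>k<n. fox_laurent k (gen a + w) * fox_laurent j (\<alpha> (gen k)))"
      using sum_gen[OF gen(1)]
      by (simp add: fox_laurent_add fox_laurent_gen distrib_right sum.distrib sum_distrib_left mult.assoc)
    finally show ?case .
  next
    case (neg a w)
    have "fox_laurent j (\<alpha> (- gen a + w)) = - tpow (- 1) * fox_laurent j (\<alpha> (gen a))
        + tpow (- 1) * (\<Sum>k<n. fox_laurent k w * fox_laurent j (\<alpha> (gen k)))"
      using neg by (simp add: hom_free_group_simps[OF hom] fox_laurent_add fox_laurent_uminus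
          degree_conj_aut[OF assms(1)])
    also have "fox_laurent j (\<alpha> (gen a)) = (\<Sum>k<n. (if a = k then 1 else 0) * fox_laurent j (\<alpha> (gen k)))"
      using sum_gen[OF neg(1)] by simp
    also have "- tpow (- 1) * \<dots> + tpow (- 1) * (\<Sum>k<n. fox_laurent k w * fox_laurent j (\<alpha> (gen k)))
        = (\<Sum>k<n. fox_laurent k (- gen a + w) * fox_laurent j (\<alpha> (gen k)))"
      unfolding sum_distrib_left sum.distrib[symmetric]
      by (intro sum.cong refl) (simp add: fox_laurent_add fox_laurent_uminus fox_laurent_gen algebra_simps)
    finally show ?case .
  qed
qed

lemma jacobian_mult:
  assumes "\<alpha> \<in> carrier (conj_aut_group n)" "\<beta> \<in> carrier (conj_aut_group n)"
  shows "jacobian n (\<alpha> \<otimes>\<^bsub>conj_aut_group n\<^esub> \<beta>) = jacobian n \<alpha> * jacobian n \<beta>"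
proof (rule eq_matI)
  fix i j assume "i < dim_row (jacobian n \<alpha> * jacobian n \<beta>)" "j < dim_col (jacobian n \<alpha> * jacobian n \<beta>)"
  then have "i < n" "j < n"
    by (simp_all add: jacobian_def)
  then show "jacobian n (\<alpha> \<otimes>\<^bsub>conj_aut_group n\<^esub> \<beta>) $$ (i, j) = (jacobian n \<alpha> * jacobian n \<beta>) $$ (i, j)"
    using conj_aut_imp_hom[OF assms(1)]
    by (simp add: jacobian_def mult_conj_aut_group compose_def scalar_prod_def lessThan_atLeast0
        fox_laurent_chain[OF assms(2)] hom_free_group_closed)
qed (simp_all add: jacobian_def)

lemma jacobian_one: "jacobian n \<one>\<^bsub>conj_aut_group n\<^esub> = 1\<^sub>m n"
  by (rule eq_matI) (auto simp: jacobian_def one_conj_aut_group fox_laurent_gen)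

lemma carrier_GL: "carrier (GL n) = Units (ring_mat TYPE(laurent) n ())"
  and mult_GL: "A \<otimes>\<^bsub>GL n\<^esub> B = A * B"
  by (simp_all add: GL_def units_of_def ring_mat_simps)

lemma group_GL: "group (GL n)"
  unfolding GL_def by (intro monoid.units_group ring.is_monoid ring_mat)

lemma jacobian_hom: "jacobian n \<in> hom (conj_aut_group n) (GL n)"
proof (rule homI)
  interpret C: group "conj_aut_group n"
    by (rule group_conj_aut_group)
  fix \<alpha> assume \<alpha>: "\<alpha> \<in> carrier (conj_aut_group n)"
  then have "jacobian n \<alpha> * jacobian n (inv\<^bsub>conj_aut_group n\<^esub> \<alpha>) = 1\<^sub>m n"
    "jacobian n (inv\<^bsub>conj_aut_group n\<^esub> \<alpha>) * jacobian n \<alpha> = 1\<^sub>m n"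
    by (simp_all add: jacobian_one flip: jacobian_mult)
  then show "jacobian n \<alpha> \<in> carrier (GL n)"
    unfolding carrier_GL Units_def by (auto simp: ring_mat_simps intro!: bexI[of _ "jacobian n (inv\<^bsub>conj_aut_group n\<^esub> \<alpha>)"])
qed (simp add: jacobian_mult mult_GL)

lemma jacobian_eps:
  assumes "i < n" "j < n" "i \<noteq> j"
  shows "jacobian n (eps n i j) = eps_mat n i j"
  by (rule eq_matI)
    (use assms in \<open>auto simp: jacobian_def eps_def eps_mat_def endo_gen fox_laurent_conjugate fox_laurent_gen\<close>)

lemma jacobian_perm: "jacobian n (perm_aut n \<pi>) = perm_mat n \<pi>"
  by (rule eq_matI) (auto simp: jacobian_def perm_aut_def perm_mat_def endo_gen fox_laurent_gen)

lemma is_rho_hat_jacobian: "is_rho_hat n (restrict (jacobian n) (carrier (conj_aut_group n)))"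
  unfolding is_rho_hat_def
  using jacobian_hom[of n] group.hom_restrict[OF group_conj_aut_group, of "jacobian n" n "GL n"]
  by (auto simp: eps_in_conj_aut_group perm_aut_in_conj_aut_group jacobian_eps jacobian_perm)

section \<open>Generators of the group of conjugating automorphisms\<close>

lemma inv_word_conv: "inv_word w = rev (map flip w)"
  by (simp add: inv_word_def flip_def case_prod_beta')

lemma inv_word_append: "inv_word (u @ v) = inv_word v @ inv_word u"
  by (simp add: inv_word_conv)

lemma abs_free_grp_inv_word: "abs_free_grp (inv_word w) = - abs_free_grp w"
  by (simp add: uminus_free_grp.abs_eq)

lemma flip_eq_iff: "flip x = y \<longleftrightarrow> x = flip y"
  by auto

lemma reduced_snoc: "reduced (u @ [x]) \<longleftrightarrow> reduced u \<and> (u = [] \<or> last u \<noteq> flip x)"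
  by (auto simp: reduced_append reduced_Cons)

lemma reduced_inv_word: "reduced w \<Longrightarrow> reduced (inv_word w)"
  unfolding reduced_def inv_word_conv successively_rev successively_map
  by (erule successively_mono) (auto simp: flip_eq_iff)

lemma hd_inv_word: "w \<noteq> [] \<Longrightarrow> hd (inv_word w) = flip (last w)"
  and last_inv_word: "w \<noteq> [] \<Longrightarrow> last (inv_word w) = flip (hd w)"
  and inv_word_eq_Nil_iff: "inv_word w = [] \<longleftrightarrow> w = []"
  by (simp_all add: inv_word_conv hd_rev last_rev last_map hd_map)

lemma common_prefix:
  obtains c a b where "u = c @ a" "v = c @ b" "a = [] \<or> b = [] \<or> hd a \<noteq> hd b"
proof (induction u v arbitrary: thesis rule: list_induct2')
  case (4 x xs y ys)
  show ?case
  proof (cases "x = y")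
    case True
    obtain c a b where "xs = c @ a" "ys = c @ b" "a = [] \<or> b = [] \<or> hd a \<noteq> hd b"
      using "4.IH" .
    then show ?thesis
      using "4.prems"[of "x # c" a b] True by simp
  qed (use "4.prems"[of "[]" "x # xs" "y # ys"] in simp)
qed auto

text \<open>
  The step of the cancellation argument, for a conjugate of a generator times a word that already
  starts with a conjugator and its middle letter. In a product of two conjugates the conjugators can
  cancel, but not far enough to reach one of the two middle letters: that would make one
  conjugator followed by its middle letter a prefix of the other conjugator, or let the two middle
  letters cancel each other.
\<close>

lemma middle_letter_survives:
  assumes tight: "\<And>e. reduced (p i @ [(\<pi> i, e)])"
    and indep: "\<And>e r. i \<noteq> j \<Longrightarrow> p j \<noteq> p i @ (\<pi> i, e) # r" "\<And>e r. i \<noteq> j \<Longrightarrow> p i \<noteq> p j @ (\<pi> j, e) # r"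
    and inj: "\<pi> i = \<pi> j \<Longrightarrow> i = j"
    and R: "reduced (p j @ (\<pi> j, e') # R)"
    and neq: "(j, e') \<noteq> flip (i, e)"
  obtains R' where "reduced (p i @ (\<pi> i, e) # R')"
    "abs_free_grp (p i @ (\<pi> i, e) # inv_word (p i)) + abs_free_grp (p j @ (\<pi> j, e') # R)
      = abs_free_grp (p i @ (\<pi> i, e) # R')"
proof -
  obtain c a b where ca: "p i = c @ a" and cb: "p j = c @ b" and ab: "a = [] \<or> b = [] \<or> hd a \<noteq> hd b"
    by (rule common_prefix)
  have indep': "p j \<noteq> p i @ (\<pi> i, e) # r" "p i \<noteq> p j @ (\<pi> j, e) # r" for e r
    using indep by (cases "i = j"; auto)+
  have last_a: "(\<pi> i, d) \<noteq> last a" if "a \<noteq> []" for d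
    using tight[of "\<not> d"] that unfolding ca reduced_snoc by (auto simp: flip_def)
  have b: "hd (b @ (\<pi> j, e') # R) \<noteq> hd a" if "a \<noteq> []"
  proof (cases b)
    case Nil
    then show ?thesis
      using that indep'(2)[of e' "tl a"] by (auto simp: ca cb)
  qed (use that ab in auto)
  have a: "hd (b @ (\<pi> j, e') # R) \<noteq> flip (\<pi> i, e)" if "a = []"
  proof (cases b)
    case Nil
    show ?thesis
      using Nil inj neq by (auto simp: flip_def)
  next
    case (Cons x b')
    then show ?thesis
      using indep'(1)[of "\<not> e" b'] that by (auto simp: ca cb flip_def)
  qed
  have red_a: "reduced (inv_word a)"
    using tight by (intro reduced_inv_word) (auto simp: ca reduced_append)
  have red_b: "reduced (b @ (\<pi> j, e') # R)"
    using R by (simp add: cb reduced_append del: append_assoc flip: append_assoc) (auto simp: reduced_append)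
  have "reduced (inv_word a @ b @ (\<pi> j, e') # R)"
    using red_a red_b b by (subst reduced_append) (auto simp: last_inv_word inv_word_eq_Nil_iff)
  moreover have "hd (inv_word a @ b @ (\<pi> j, e') # R) \<noteq> flip (\<pi> i, e)"
    using a last_a[of e]
    by (cases "a = []") (auto simp: hd_inv_word inv_word_eq_Nil_iff inv_word_conv[of "[]"] flip_eq_iff)
  ultimately have "reduced ((p i @ [(\<pi> i, e)]) @ inv_word a @ b @ (\<pi> j, e') # R)"
    using tight[of e] by (subst reduced_append) auto
  then show thesis
    by (intro that[of "inv_word a @ b @ (\<pi> j, e') # R"])
      (simp_all add: ca cb inv_word_append abs_free_grp_simps abs_free_grp_inv_word add.assoc
        diff_conv_add_uminus del: add_uminus_conv_diff)
qed

lemma hom_letter: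
  assumes "\<alpha> \<in> hom (free_group n) (free_group n)" "i < n"
    and "\<alpha> (gen i) = abs_free_grp u + gen k - abs_free_grp u"
  shows "\<alpha> (letter (i, e)) = abs_free_grp (u @ (k, e) # inv_word u)"
  using assms(2,3)
  by (cases e)
    (simp_all add: hom_free_group_simps[OF assms(1)] abs_free_grp_simps abs_free_grp_inv_word
      minus_add add.assoc diff_conv_add_uminus del: add_uminus_conv_diff)

lemma image_of_reduced_word:
  assumes hom: "\<alpha> \<in> hom (free_group n) (free_group n)"
    and inj: "inj_on \<pi> {..<n}"
    and \<alpha>: "\<And>i. i < n \<Longrightarrow> \<alpha> (gen i) = abs_free_grp (p i) + gen (\<pi> i) - abs_free_grp (p i)"
    and tight: "\<And>i e. i < n \<Longrightarrow> reduced (p i @ [(\<pi> i, e)])"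
    and indep: "\<And>i j e r. i < n \<Longrightarrow> j < n \<Longrightarrow> i \<noteq> j \<Longrightarrow> p i \<noteq> p j @ (\<pi> j, e) # r"
    and w: "reduced ((i, e) # w)" "fst ` set ((i, e) # w) \<subseteq> {..<n}"
  shows "\<exists>R. reduced (p i @ (\<pi> i, e) # R) \<and> \<alpha> (abs_free_grp ((i, e) # w)) = abs_free_grp (p i @ (\<pi> i, e) # R)"
  using w
proof (induction w arbitrary: i e)
  case Nil
  have "reduced (p i @ (\<pi> i, e) # inv_word (p i))"
  proof (cases "p i = []")
    case False
    then have "flip (last (p i)) \<noteq> flip (\<pi> i, e)"
      using tight[of i "\<not> e"] Nil(2) by (auto simp: reduced_append flip_def)
    then have "reduced ((p i @ [(\<pi> i, e)]) @ inv_word (p i))"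
      using tight[of i e] Nil(2) False
      by (subst reduced_append) (auto simp: hd_inv_word reduced_append intro!: reduced_inv_word)
    then show ?thesis
      by simp
  qed (simp add: inv_word_conv reduced_Cons)
  moreover have "\<alpha> (abs_free_grp [(i, e)]) = abs_free_grp (p i @ (\<pi> i, e) # inv_word (p i))"
    using hom_letter[OF hom _ \<alpha>, of i e] Nil(2) by (simp add: abs_free_grp_singleton)
  ultimately show ?case
    by blast
next
  case (Cons x w)
  obtain j e' where x: "x = (j, e')"
    by (cases x)
  have lt: "i < n" "j < n" and red: "reduced ((j, e') # w)" and neq: "(j, e') \<noteq> flip (i, e)"
    using Cons.prems by (auto simp: x reduced_Cons)
  obtain R where R: "reduced (p j @ (\<pi> j, e') # R)"
    "\<alpha> (abs_free_grp ((j, e') # w)) = abs_free_grp (p j @ (\<pi> j, e') # R)"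
    using Cons.IH[of j e'] Cons.prems red by (auto simp: x)
  obtain R' where R': "reduced (p i @ (\<pi> i, e) # R')"
    "abs_free_grp (p i @ (\<pi> i, e) # inv_word (p i)) + abs_free_grp (p j @ (\<pi> j, e') # R)
      = abs_free_grp (p i @ (\<pi> i, e) # R')"
  proof (rule middle_letter_survives[where p = p and \<pi> = \<pi> and i = i and j = j and R = R and e = e and e' = e'])
    show "\<pi> i = \<pi> j \<Longrightarrow> i = j"
      using inj lt by (auto dest: inj_onD)
  qed (use tight indep lt R neq in auto)
  have "letter (i, e) \<in> carrier (free_group n)"
    using lt by (simp add: letter_def)
  moreover have "abs_free_grp (x # w) \<in> carrier (free_group n)"
    using Cons.prems(2) by (intro abs_free_grp_in_free_group) simp
  ultimately have "\<alpha> (abs_free_grp ((i, e) # x # w)) = \<alpha> (letter (i, e)) + \<alpha> (abs_free_grp (x # w))"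
    by (simp add: abs_free_grp_Cons[of "(i, e)"] hom_free_group_add[OF hom])
  then show ?case
    using R' R(2) hom_letter[OF hom lt(1) \<alpha>[OF lt(1)], of e] by (auto simp: x)
qed

text \<open>
  Surjectivity makes the one-letter word \<open>gen (\<pi> i)\<close> the image of some reduced word. This image starts
  with a conjugator and its middle letter, so that conjugator is empty and belongs to \<open>i\<close>.
\<close>

lemma tight_independent_imp_trivial:
  assumes \<alpha>_auto: "\<alpha> \<in> auto (free_group n)"
    and \<pi>: "\<pi> permutes {..<n}"
    and \<alpha>: "\<And>i. i < n \<Longrightarrow> \<alpha> (gen i) = abs_free_grp (p i) + gen (\<pi> i) - abs_free_grp (p i)"
    and tight: "\<And>i e. i < n \<Longrightarrow> reduced (p i @ [(\<pi> i, e)])"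
    and indep: "\<And>i j e r. i < n \<Longrightarrow> j < n \<Longrightarrow> i \<noteq> j \<Longrightarrow> p i \<noteq> p j @ (\<pi> j, e) # r"
    and "i < n"
  shows "p i = []"
proof -
  have "\<pi> i < n"
    using permutes_in_image[OF \<pi>] \<open>i < n\<close> by auto
  then have "gen (\<pi> i) \<in> \<alpha> ` carrier (free_group n)"
    using \<alpha>_auto by (simp add: auto_def Bij_def bij_betw_def)
  then obtain g where g: "g \<in> carrier (free_group n)" "\<alpha> g = gen (\<pi> i)"
    by auto
  obtain u' where u': "g = abs_free_grp u'" "fst ` set u' \<subseteq> {..<n}"
    using g(1) by (rule free_group_cases)
  define u where "u = normal_form u'"
  have u: "g = abs_free_grp u" "fst ` set u \<subseteq> {..<n}" "reduced u"
    using u' set_normal_form[of u'] by (auto simp: u_def abs_free_grp_normal_form reduced_normal_form)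
  have gen: "gen (\<pi> i) = abs_free_grp [(\<pi> i, False)]" "reduced [(\<pi> i, False)]"
    by (simp_all add: abs_free_grp_singleton reduced_Cons)
  note hom = auto_imp_hom[OF \<alpha>_auto]
  show ?thesis
  proof (cases u)
    case Nil
    then have "abs_free_grp [(\<pi> i, False)] = abs_free_grp []"
      using u g gen by (simp add: hom_free_group_zero[OF hom])
    then have "[(\<pi> i, False)] = []"
      by (rule reduced_unique) (simp_all add: reduced_Cons)
    then show ?thesis
      by simp
  next
    case (Cons x u'')
    obtain j e where x: "x = (j, e)"
      by (cases x)
    have "j < n"
      using u(2) by (simp add: Cons x)
    have "\<exists>R. reduced (p j @ (\<pi> j, e) # R) \<and> \<alpha> (abs_free_grp ((j, e) # u'')) = abs_free_grp (p j @ (\<pi> j, e) # R)"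
      by (rule image_of_reduced_word[OF hom permutes_inj_on[OF \<pi>] \<alpha> tight indep])
        (use u in \<open>auto simp: Cons x\<close>)
    then obtain R where "reduced (p j @ (\<pi> j, e) # R)" "\<alpha> g = abs_free_grp (p j @ (\<pi> j, e) # R)"
      using u by (auto simp: Cons x)
    then have "p j @ (\<pi> j, e) # R = [(\<pi> i, False)]"
      using g gen by (intro reduced_unique) simp_all
    then have "p j = []" "\<pi> j = \<pi> i"
      by (auto simp: append_eq_Cons_conv)
    then show ?thesis
      using permutes_inj[OF \<pi>] by (auto dest: injD)
  qed
qed

definition conj_aut_generators :: "nat \<Rightarrow> (nat free_grp \<Rightarrow> nat free_grp) set" where
  "conj_aut_generators n = {eps n i j |i j. i < n \<and> j < n \<and> i \<noteq> j} \<union> {perm_aut n \<pi> |\<pi>. \<pi> permutes {..<n}}"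

lemma conj_aut_generators_subset: "conj_aut_generators n \<subseteq> carrier (conj_aut_group n)"
  by (auto simp: conj_aut_generators_def eps_in_conj_aut_group perm_aut_in_conj_aut_group)

lemma length_rcons: "length (rcons x w) \<le> Suc (length w)"
  by (cases w) auto

lemma length_normal_form_less: "\<not> reduced w \<Longrightarrow> length (normal_form w) < length w"
proof (induction w)
  case (Cons x w)
  show ?case
  proof (cases "reduced w")
    case True
    then obtain w' where w': "w = flip x # w'"
      using Cons.prems by (cases w) (auto simp: reduced_Cons)
    have "normal_form (x # w) = w'"
      using normal_form_reduced[OF True] by (simp add: w' del: normal_form_simps(2)) (simp add: w')
    then show ?thesis
      by (simp add: w')
  next
    case False
    then show ?thesis
      using Cons.IH length_rcons[of x "normal_form w"] by simp
  qed
qed simp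

lemma shorten_conjugator:
  assumes "\<not> reduced (u @ [(k, e)])"
  obtains v where "length v < length u" "set v \<subseteq> set u"
    "abs_free_grp v + gen k - abs_free_grp v = abs_free_grp u + gen k - abs_free_grp u"
proof (cases "reduced u")
  case False
  then show thesis
    using that[of "normal_form u"] length_normal_form_less[of u] set_normal_form[of u]
    by (simp add: abs_free_grp_normal_form)
next
  case True
  then have u: "u \<noteq> []" "last u = (k, \<not> e)"
    using assms by (auto simp: reduced_append reduced_Cons flip_def prod_eq_iff)
  then have "abs_free_grp u = abs_free_grp (butlast u) + letter (k, \<not> e)"
    by (metis append_butlast_last_id abs_free_grp_append abs_free_grp_singleton)
  then have "abs_free_grp (butlast u) + gen k - abs_free_grp (butlast u) = abs_free_grp u + gen k - abs_free_grp u"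
    by (cases e) (simp_all add: diff_conv_add_uminus minus_add add.assoc del: add_uminus_conv_diff)
  then show thesis
    using that[of "butlast u"] u by (auto dest: in_set_butlastD)
qed

lemma sum_length_update:
  assumes "i < (n :: nat)" "length v < length (p i)"
  shows "(\<Sum>l<n. length ((p(i := v)) l)) < (\<Sum>l<n. length (p l))"
  using assms by (intro sum_strict_mono_ex1) auto

text \<open>
  The reduction of an arbitrary conjugating automorphism to a permutation, by induction on the
  total length of the conjugators. If \<open>p i = p j @ (\<pi> j, e) # r\<close>, then conjugating \<open>\<alpha> (gen i)\<close> by a
  suitable power of \<open>\<alpha> (gen j)\<close> replaces \<open>p i\<close> by the shorter word \<open>p j @ r\<close>.
\<close>

lemma conj_aut_in_generate:
  assumes "\<alpha> \<in> carrier (conj_aut_group n)" "\<pi> permutes {..<n}"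
    and "\<And>i. i < n \<Longrightarrow> fst ` set (p i) \<subseteq> {..<n}"
    and "\<And>i. i < n \<Longrightarrow> \<alpha> (gen i) = abs_free_grp (p i) + gen (\<pi> i) - abs_free_grp (p i)"
  shows "\<alpha> \<in> generate (conj_aut_group n) (conj_aut_generators n)"
  using assms
proof (induction "\<Sum>i<n. length (p i)" arbitrary: \<alpha> p rule: less_induct)
  case less
  note \<alpha> = less.prems(1) and \<pi> = less.prems(2) and letters = less.prems(3) and conj = less.prems(4)
  interpret C: group "conj_aut_group n"
    by (rule group_conj_aut_group)
  consider (loose) i e where "i < n" "\<not> reduced (p i @ [(\<pi> i, e)])"
    | (dependent) i j e r where "i < n" "j < n" "i \<noteq> j" "p i = p j @ (\<pi> j, e) # r"
    | (good) "\<And>i e. i < n \<Longrightarrow> reduced (p i @ [(\<pi> i, e)])"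
      "\<And>i j e r. i < n \<Longrightarrow> j < n \<Longrightarrow> i \<noteq> j \<Longrightarrow> p i \<noteq> p j @ (\<pi> j, e) # r"
    by blast
  then show ?case
  proof cases
    case loose
    obtain v where v: "length v < length (p i)" "set v \<subseteq> set (p i)"
      "abs_free_grp v + gen (\<pi> i) - abs_free_grp v = abs_free_grp (p i) + gen (\<pi> i) - abs_free_grp (p i)"
      using loose(2) by (rule shorten_conjugator)
    show ?thesis
    proof (rule less.hyps[where p = "p(i := v)"])
      show "fst ` set ((p(i := v)) l) \<subseteq> {..<n}" if "l < n" for l
        using letters[OF that] v(2) by auto
    qed (use \<alpha> \<pi> conj v sum_length_update[of i n v p] loose(1) in auto)
  next
    case dependent
    \<comment> \<open>The sign \<open>e\<close> of the letter to be removed decides between \<open>eps n i j\<close> and its inverse.\<close>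
    let ?E = "eps n i j"
    have E: "?E \<in> carrier (conj_aut_group n)" "?E \<in> conj_aut_generators n"
      using dependent by (auto simp: eps_in_conj_aut_group conj_aut_generators_def)
    have comp: "(?E \<otimes>\<^bsub>conj_aut_group n\<^esub> \<beta>) (gen l) =
        (if l = i then - \<beta> (gen j) + \<beta> (gen i) + \<beta> (gen j) else \<beta> (gen l))"
      if "\<beta> \<in> carrier (conj_aut_group n)" "l < n" for \<beta> l
      using dependent that
      by (simp add: mult_conj_aut_group compose_def eps_def endo_gen hom_free_group_simps[OF conj_aut_imp_hom[OF that(1)]])
    let ?p = "p(i := p j @ r)"
    have shorter: "(\<Sum>l<n. length (?p l)) < (\<Sum>l<n. length (p l))"
      using dependent by (intro sum_length_update) simp_all
    have letters': "fst ` set (?p l) \<subseteq> {..<n}" if "l < n" for l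
      using letters[OF that] letters[OF dependent(1)] dependent by auto
    show ?thesis
    proof (cases e)
      case False
      let ?\<beta> = "?E \<otimes>\<^bsub>conj_aut_group n\<^esub> \<alpha>"
      have "?\<beta> \<in> generate (conj_aut_group n) (conj_aut_generators n)"
      proof (rule less.hyps[where p = ?p])
        fix l assume "l < n"
        then show "?\<beta> (gen l) = abs_free_grp (?p l) + gen (\<pi> l) - abs_free_grp (?p l)"
          using dependent False
          by (simp add: comp[OF \<alpha>] conj abs_free_grp_simps diff_conv_add_uminus minus_add add.assoc
              del: add_uminus_conv_diff)
      qed (use E \<alpha> \<pi> shorter letters' in auto)
      moreover have "\<alpha> = inv\<^bsub>conj_aut_group n\<^esub> ?E \<otimes>\<^bsub>conj_aut_group n\<^esub> ?\<beta>"
        using E \<alpha> by (simp flip: C.m_assoc)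
      ultimately show ?thesis
        using generate.eng generate.inv E(2) by metis
    next
      case True
      let ?\<beta> = "inv\<^bsub>conj_aut_group n\<^esub> ?E \<otimes>\<^bsub>conj_aut_group n\<^esub> \<alpha>"
      have \<beta>: "?\<beta> \<in> carrier (conj_aut_group n)" "\<alpha> = ?E \<otimes>\<^bsub>conj_aut_group n\<^esub> ?\<beta>"
        using E \<alpha> by (simp_all flip: C.m_assoc)
      have \<beta>_gen: "?\<beta> (gen l) = \<alpha> (gen l)" if "l < n" "l \<noteq> i" for l
        using comp[OF \<beta>(1) that(1)] that \<beta>(2) by simp
      have "\<alpha> (gen i) = - \<alpha> (gen j) + ?\<beta> (gen i) + \<alpha> (gen j)"
        using comp[OF \<beta>(1) dependent(1)] \<beta>(2) \<beta>_gen[of j] dependent by simp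
      then have \<beta>_gen_i: "?\<beta> (gen i) = \<alpha> (gen j) + \<alpha> (gen i) - \<alpha> (gen j)"
        by (simp add: add.assoc)
      have "?\<beta> \<in> generate (conj_aut_group n) (conj_aut_generators n)"
      proof (rule less.hyps[where p = ?p])
        fix l assume "l < n"
        then show "?\<beta> (gen l) = abs_free_grp (?p l) + gen (\<pi> l) - abs_free_grp (?p l)"
          using dependent True
          by (cases "l = i") (simp_all add: \<beta>_gen \<beta>_gen_i conj abs_free_grp_simps diff_conv_add_uminus minus_add
              add.assoc del: add_uminus_conv_diff)
      qed (use \<beta> \<pi> shorter letters' in auto)
      then show ?thesis
        using generate.eng[OF generate.incl[OF E(2)]] \<beta>(2) by metis
    qed
  next
    case good
    have "p i = []" if "i < n" for i
      using tight_independent_imp_trivial[OF conj_aut_imp_auto[OF \<alpha>] \<pi> conj good that] .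
    then have "\<alpha> = perm_aut n \<pi>"
      using conj by (intro conj_aut_eqI[OF \<alpha> perm_aut_in_conj_aut_group[OF \<pi>]])
        (simp add: perm_aut_def endo_gen)
    then show ?thesis
      using \<pi> by (auto simp: conj_aut_generators_def intro!: generate.incl)
  qed
qed

text \<open>The theorem of McCool and Savushkina on generators of the group of conjugating automorphisms.\<close>

theorem generate_conj_aut_group:
  "generate (conj_aut_group n) (conj_aut_generators n) = carrier (conj_aut_group n)"
proof
  show "generate (conj_aut_group n) (conj_aut_generators n) \<subseteq> carrier (conj_aut_group n)"
    by (rule group.generate_incl[OF group_conj_aut_group conj_aut_generators_subset])
  show "carrier (conj_aut_group n) \<subseteq> generate (conj_aut_group n) (conj_aut_generators n)"
  proof
    fix \<alpha> assume \<alpha>: "\<alpha> \<in> carrier (conj_aut_group n)"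
    then obtain \<pi> f where \<pi>: "\<pi> permutes {..<n}"
      and f: "\<And>i. i < n \<Longrightarrow> f i \<in> carrier (free_group n)"
        "\<And>i. i < n \<Longrightarrow> \<alpha> (gen i) = - f i + gen (\<pi> i) + f i"
      by (metis conj_autE)
    have "\<exists>w. - f i = abs_free_grp w \<and> fst ` set w \<subseteq> {..<n}" if "i < n" for i
      using uminus_in_free_group[OF f(1)[OF that]] by (elim free_group_cases) auto
    then obtain p where p: "\<And>i. i < n \<Longrightarrow> - f i = abs_free_grp (p i) \<and> fst ` set (p i) \<subseteq> {..<n}"
      by metis
    have "\<alpha> (gen i) = abs_free_grp (p i) + gen (\<pi> i) - abs_free_grp (p i)" if "i < n" for i
      using f(2)[OF that] p[OF that] by (metis minus_minus diff_conv_add_uminus)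
    with \<alpha> \<pi> p show "\<alpha> \<in> generate (conj_aut_group n) (conj_aut_generators n)"
      by (intro conj_aut_in_generate) auto
  qed
qed

lemma is_rho_hat_unique:
  assumes "is_rho_hat n \<rho>" "is_rho_hat n \<rho>'"
  shows "\<rho> = \<rho>'"
proof (rule extensionalityI)
  show "\<rho> \<in> extensional (carrier (conj_aut_group n))" "\<rho>' \<in> extensional (carrier (conj_aut_group n))"
    using assms by (simp_all add: is_rho_hat_def)
  have eq: "\<rho> \<beta> = \<rho>' \<beta>" if "\<beta> \<in> conj_aut_generators n" for \<beta>
    using that assms by (auto simp: is_rho_hat_def conj_aut_generators_def)
  fix \<alpha> assume "\<alpha> \<in> carrier (conj_aut_group n)"
  then show "\<rho> \<alpha> = \<rho>' \<alpha>"
    using assms eq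
    by (intro hom_eq_on_generate[OF group_conj_aut_group[of n] group_GL[of n] _ _
          conj_aut_generators_subset[of n], where x = \<alpha> and h = \<rho> and k = \<rho>'])
      (auto simp: is_rho_hat_def generate_conj_aut_group)
qed

section \<open>The braid group inside the group of conjugating automorphisms\<close>

definition word_eval :: "('g, 'b) monoid_scheme \<Rightarrow> ('a \<Rightarrow> 'g) \<Rightarrow> ('a \<times> bool) list \<Rightarrow> 'g" where
  "word_eval G f w =
    foldr (\<lambda>x y. (if snd x then inv\<^bsub>G\<^esub> f (fst x) else f (fst x)) \<otimes>\<^bsub>G\<^esub> y) w \<one>\<^bsub>G\<^esub>"

context group
begin

lemma word_eval_simps [simp]:
  "word_eval G f [] = \<one>"
  "word_eval G f (x # w) = (if snd x then inv f (fst x) else f (fst x)) \<otimes> word_eval G f w"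
  by (simp_all add: word_eval_def)

lemma word_eval_closed:
  assumes "\<And>a. f a \<in> carrier G"
  shows "word_eval G f w \<in> carrier G"
  by (induction w) (simp_all add: assms)

lemma word_eval_append:
  assumes "\<And>a. f a \<in> carrier G"
  shows "word_eval G f (u @ v) = word_eval G f u \<otimes> word_eval G f v"
  by (induction u) (simp_all add: assms m_assoc word_eval_closed[where f = f, OF assms])

lemma word_eval_cong:
  fixes f :: "'c \<Rightarrow> 'a"
  assumes "\<And>a. f a \<in> carrier G" "free_eq u v"
  shows "word_eval G f u = word_eval G f v"
  using assms(2)
proof (rule free_eq_induct)
  fix u v :: "('c \<times> bool) list" assume "cancels u v"
  then obtain p a b q where uv: "u = p @ [(a, b), (a, \<not> b)] @ q" "v = p @ q"
    by (auto elim: cancels.cases)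
  have "word_eval G f ([(a, b), (a, \<not> b)] @ q) = word_eval G f q"
    by (simp add: assms(1) word_eval_closed[where f = f, OF assms(1)] flip: m_assoc)
  then show "word_eval G f u = word_eval G f v"
    unfolding uv by (simp only: word_eval_append[OF assms(1)])
qed auto

end

text \<open>
  The lifting \<open>free_lift\<close> needs a type of class \<open>group_add\<close>, whereas here the target is a group on a
  carrier; hence the separate evaluation of words.
\<close>

lemma free_group_universal:
  assumes "group G" "\<And>i. i < m \<Longrightarrow> f i \<in> carrier G"
  obtains h where "h \<in> hom (free_group m) G" "\<And>i. i < m \<Longrightarrow> h (gen i) = f i"
proof -
  interpret group G
    by (rule assms(1))
  \<comment> \<open>Representatives of elements of the subgroup may contain letters outside the basis.\<close>
  define f' where "f' i = (if i < m then f i else \<one>\<^bsub>G\<^esub>)" for i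
  have f': "f' i \<in> carrier G" for i
    using assms(2) by (simp add: f'_def)
  define h where "h g = word_eval G f' (rep_free_grp g)" for g
  have h: "h (abs_free_grp w) = word_eval G f' w" for w
    unfolding h_def
    by (rule word_eval_cong[where f = f', OF f']) (metis abs_free_grp_eq_iff Quotient3_abs_rep Quotient3_free_grp)
  show thesis
  proof (rule that)
    show "h \<in> hom (free_group m) G"
    proof (rule homI)
      fix v w :: "nat free_grp"
      obtain v' w' where "v = abs_free_grp v'" "w = abs_free_grp w'"
        by (metis abs_free_grp_cases)
      then show "h (v \<otimes>\<^bsub>free_group m\<^esub> w) = h v \<otimes>\<^bsub>G\<^esub> h w"
        by (simp add: h word_eval_append[where f = f', OF f'] flip: abs_free_grp_append)
    qed (simp add: h_def word_eval_closed[where f = f', OF f'])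
    show "h (gen i) = f i" if "i < m" for i
      using h[of "[(i, False)]"] that assms(2) by (simp add: abs_free_grp_singleton f'_def)
  qed
qed

lemma mult_endo_gen:
  assumes "\<alpha> \<in> carrier (conj_aut_group n)" "l < n"
  shows "(\<alpha> \<otimes>\<^bsub>conj_aut_group n\<^esub> \<beta>) (gen l) = \<beta> (\<alpha> (gen l))"
  using assms by (simp add: mult_conj_aut_group compose_def)

lemma artin_aut_gen:
  assumes "l < n"
  shows "artin_aut n i (gen l) = (if l = i then gen i + gen (i + 1) - gen i
                                 else if l = i + 1 then gen i else gen l)"
  using assms by (simp add: artin_aut_def endo_gen)

lemma artin_aut_braid:
  assumes "Suc (Suc i) < n"
  shows "artin_aut n i \<otimes>\<^bsub>conj_aut_group n\<^esub> artin_aut n (Suc i) \<otimes>\<^bsub>conj_aut_group n\<^esub> artin_aut n i =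
    artin_aut n (Suc i) \<otimes>\<^bsub>conj_aut_group n\<^esub> artin_aut n i \<otimes>\<^bsub>conj_aut_group n\<^esub> artin_aut n (Suc i)"
proof -
  interpret C: group "conj_aut_group n"
    by (rule group_conj_aut_group)
  let ?s = "artin_aut n i" and ?t = "artin_aut n (Suc i)"
  have C: "?s \<in> carrier (conj_aut_group n)" "?t \<in> carrier (conj_aut_group n)"
    using assms by (simp_all add: artin_aut_in_conj_aut_group)
  note hom = hom_free_group_simps[OF conj_aut_imp_hom[OF C(1)]] hom_free_group_simps[OF conj_aut_imp_hom[OF C(2)]]
  show ?thesis
  proof (rule conj_aut_eqI)
    fix l assume l: "l < n"
    consider "l = i" | "l = Suc i" | "l = Suc (Suc i)" | "l \<noteq> i" "l \<noteq> Suc i" "l \<noteq> Suc (Suc i)"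
      by blast
    then show "(?s \<otimes>\<^bsub>conj_aut_group n\<^esub> ?t \<otimes>\<^bsub>conj_aut_group n\<^esub> ?s) (gen l) =
        (?t \<otimes>\<^bsub>conj_aut_group n\<^esub> ?s \<otimes>\<^bsub>conj_aut_group n\<^esub> ?t) (gen l)"
      using assms C l
      by cases (simp_all add: mult_endo_gen artin_aut_gen hom diff_conv_add_uminus minus_add add.assoc
          del: add_uminus_conv_diff)
  qed (use C in auto)
qed

lemma artin_aut_commute:
  assumes "i + 1 < n" "j + 1 < n" "i + 2 \<le> j \<or> j + 2 \<le> i"
  shows "artin_aut n i \<otimes>\<^bsub>conj_aut_group n\<^esub> artin_aut n j = artin_aut n j \<otimes>\<^bsub>conj_aut_group n\<^esub> artin_aut n i"
proof -
  interpret C: group "conj_aut_group n"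
    by (rule group_conj_aut_group)
  let ?s = "artin_aut n i" and ?t = "artin_aut n j"
  have C: "?s \<in> carrier (conj_aut_group n)" "?t \<in> carrier (conj_aut_group n)"
    using assms by (simp_all add: artin_aut_in_conj_aut_group)
  note hom = hom_free_group_simps[OF conj_aut_imp_hom[OF C(1)]] hom_free_group_simps[OF conj_aut_imp_hom[OF C(2)]]
  show ?thesis
  proof (rule conj_aut_eqI)
    fix l assume l: "l < n"
    consider "l = i" | "l = i + 1" | "l = j" | "l = j + 1" | "l \<noteq> i" "l \<noteq> i + 1" "l \<noteq> j" "l \<noteq> j + 1"
      by blast
    then show "(?s \<otimes>\<^bsub>conj_aut_group n\<^esub> ?t) (gen l) = (?t \<otimes>\<^bsub>conj_aut_group n\<^esub> ?s) (gen l)"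
      using assms C l
      by cases (auto simp add: mult_endo_gen artin_aut_gen hom diff_conv_add_uminus
          simp del: add_uminus_conv_diff)
  qed (use C in auto)
qed

lemma braid_relators_subset: "braid_relators n \<subseteq> carrier (free_group (n - 1))"
  by (auto simp: braid_relators_def)

lemma normal_braid_kernel: "braid_kernel n \<lhd> free_group (n - 1)"
proof -
  interpret F: group "free_group (n - 1)"
    by (rule group_free_group)
  let ?\<N> = "{N. N \<lhd> free_group (n - 1) \<and> braid_relators n \<subseteq> N}"
  have "carrier (free_group (n - 1)) \<in> ?\<N>"
    using F.normal_invI[OF F.subgroup_self] braid_relators_subset
    by (simp del: One_nat_def mult_free_group)
  then have "subgroup (\<Inter>?\<N>) (free_group (n - 1))"
    by (intro F.subgroups_Inter) (auto intro: normal_imp_subgroup)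
  then show ?thesis
    unfolding braid_kernel_def
  proof (rule F.normal_invI)
    fix g h assume "g \<in> carrier (free_group (n - 1))" "h \<in> \<Inter>?\<N>"
    then show "g \<otimes>\<^bsub>free_group (n - 1)\<^esub> h \<otimes>\<^bsub>free_group (n - 1)\<^esub> inv\<^bsub>free_group (n - 1)\<^esub> g \<in> \<Inter>?\<N>"
      using F.normal_invE(2) by blast
  qed
qed

lemma braid_kernel_subset:
  "N \<lhd> free_group (n - 1) \<Longrightarrow> braid_relators n \<subseteq> N \<Longrightarrow> braid_kernel n \<subseteq> N"
  by (auto simp: braid_kernel_def)

lemma coset_hom_braid_group:
  "(\<lambda>g. braid_kernel n #>\<^bsub>free_group (n - 1)\<^esub> g) \<in> hom (free_group (n - 1)) (braid_group n)"
  unfolding braid_group_def by (rule normal.r_coset_hom_Mod[OF normal_braid_kernel])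

lemma group_braid_group: "group (braid_group n)"
  unfolding braid_group_def by (rule normal.factorgroup_is_group[OF normal_braid_kernel])

lemma carrier_braid_group:
  "carrier (braid_group n) = (\<lambda>g. braid_kernel n #>\<^bsub>free_group (n - 1)\<^esub> g) ` carrier (free_group (n - 1))"
  by (simp add: braid_group_def carrier_FactGroup)

text \<open>
  Existence is von Dyck's theorem: the map on the free group sends the relators to the identity, so
  its kernel contains their normal closure.
\<close>

lemma ex1_artin_embedding:
  "\<exists>!\<iota>. \<iota> \<in> hom (braid_group n) (conj_aut_group n) \<inter> extensional (carrier (braid_group n)) \<and>
     (\<forall>i. i + 1 < n \<longrightarrow> \<iota> (braid_sigma n i) = artin_aut n i)" (is "\<exists>!\<iota>. ?P \<iota>")
proof (rule ex_ex1I)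
  let ?F = "free_group (n - 1)" and ?C = "conj_aut_group n"
  interpret F: group ?F
    by (rule group_free_group)
  interpret C: group ?C
    by (rule group_conj_aut_group)
  obtain h where h: "h \<in> hom ?F ?C" "\<And>i. i < n - 1 \<Longrightarrow> h (gen i) = artin_aut n i"
    using free_group_universal[OF group_conj_aut_group, of "n - 1" "artin_aut n" n]
    by (auto simp: artin_aut_in_conj_aut_group less_diff_conv)
  interpret h: group_hom ?F ?C h
    by unfold_locales (rule h(1))
  have h_add: "h (v + w) = h v \<otimes>\<^bsub>?C\<^esub> h w" if "v \<in> carrier ?F" "w \<in> carrier ?F" for v w
    using h.hom_mult[OF that] by simp
  have diff: "v - w \<in> kernel ?F ?C h" if "v \<in> carrier ?F" "w \<in> carrier ?F" "h v = h w" for v w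
  proof -
    have "h (v - w) = h v \<otimes>\<^bsub>?C\<^esub> inv\<^bsub>?C\<^esub> h w"
      using that h.hom_inv[of w] h_add[of v "- w"] by (simp add: inv_free_group)
    then show ?thesis
      using that by (simp add: kernel_def)
  qed
  have "braid_relators n \<subseteq> kernel ?F ?C h"
    unfolding braid_relators_def
    using artin_aut_braid[of _ n] artin_aut_commute[of _ n]
    by (auto intro!: diff simp: h_add h(2) less_diff_conv simp del: One_nat_def simp flip: Suc_eq_plus1)
  then have "braid_kernel n \<subseteq> kernel ?F ?C h"
    by (intro braid_kernel_subset h.normal_kernel)
  then obtain g where g: "g \<in> hom (braid_group n) ?C"
    "\<And>x. x \<in> carrier ?F \<Longrightarrow> g (braid_kernel n #>\<^bsub>?F\<^esub> x) = h x"
    using h.FactGroup_universal_kernel[OF normal_braid_kernel] unfolding braid_group_def by metis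
  have "restrict g (carrier (braid_group n)) \<in> hom (braid_group n) ?C"
    by (rule group.hom_restrict[OF group_braid_group g(1)]) simp
  moreover have "restrict g (carrier (braid_group n)) (braid_sigma n i) = artin_aut n i" if "i + 1 < n" for i
    using that g(2)[of "gen i"] h(2)[of i]
    by (simp add: braid_sigma_def carrier_braid_group less_diff_conv)
  ultimately show "\<exists>\<iota>. ?P \<iota>"
    by (intro exI[of _ "restrict g (carrier (braid_group n))"]) simp
next
  let ?F = "free_group (n - 1)" and ?C = "conj_aut_group n"
  fix \<iota> \<kappa> assume \<iota>: "?P \<iota>" and \<kappa>: "?P \<kappa>"
  show "\<iota> = \<kappa>"
  proof (rule extensionalityI)
    show "\<iota> \<in> extensional (carrier (braid_group n))" "\<kappa> \<in> extensional (carrier (braid_group n))"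
      using \<iota> \<kappa> by auto
    fix b assume "b \<in> carrier (braid_group n)"
    then obtain x where x: "x \<in> carrier ?F" "b = braid_kernel n #>\<^bsub>?F\<^esub> x"
      by (auto simp: carrier_braid_group)
    have sigma: "\<iota> (braid_kernel n #>\<^bsub>?F\<^esub> gen i) = \<kappa> (braid_kernel n #>\<^bsub>?F\<^esub> gen i)" if "i + 1 < n" for i
      using \<iota> \<kappa> that unfolding braid_sigma_def by simp
    have "(\<iota> \<circ> (\<lambda>g. braid_kernel n #>\<^bsub>?F\<^esub> g)) x = (\<kappa> \<circ> (\<lambda>g. braid_kernel n #>\<^bsub>?F\<^esub> g)) x"
    proof (rule hom_eq_on_generate[OF group_free_group group_conj_aut_group])
      show "\<iota> \<circ> (\<lambda>g. braid_kernel n #>\<^bsub>?F\<^esub> g) \<in> hom ?F ?C" "\<kappa> \<circ> (\<lambda>g. braid_kernel n #>\<^bsub>?F\<^esub> g) \<in> hom ?F ?C"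
        using Group.hom_compose[OF coset_hom_braid_group] \<iota> \<kappa> by blast+
      show "x \<in> generate ?F (gen ` {..<n - 1})"
        using x by (simp add: generate_free_group)
    qed (use sigma in \<open>auto simp: less_diff_conv simp del: One_nat_def\<close>)
    then show "\<iota> b = \<kappa> b"
      by (simp add: x)
  qed
qed

lemma artin_embedding_in_conj_aut_group:
  assumes "b \<in> carrier (braid_group n)"
  shows "artin_embedding n b \<in> carrier (conj_aut_group n)"
  using theI'[OF ex1_artin_embedding[of n]] assms unfolding artin_embedding_def[symmetric]
  by (auto intro: hom_in_carrier)

section \<open>The extension of the Burau representation\<close>

lemma burau_conv_jacobian: "burau n b = jacobian n (artin_embedding n b)"
  by (simp add: burau_def jacobian_def fox_laurent_def)

theorem mainTheorem3:
  fixes n :: nat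
  assumes "n \<ge> 2"
  shows "(\<exists>!\<rho>. is_rho_hat n \<rho>) \<and>
    (\<forall>\<rho>. is_rho_hat n \<rho> \<longrightarrow>
      (\<forall>b\<in>carrier (braid_group n). \<rho> (artin_embedding n b) = burau n b))"
proof (intro conjI allI impI ballI)
  let ?\<rho> = "restrict (jacobian n) (carrier (conj_aut_group n))"
  show "\<exists>!\<rho>. is_rho_hat n \<rho>"
    using is_rho_hat_jacobian is_rho_hat_unique by blast
  fix \<rho> b assume "is_rho_hat n \<rho>" and b: "b \<in> carrier (braid_group n)"
  then have "\<rho> = ?\<rho>"
    using is_rho_hat_jacobian is_rho_hat_unique by blast
  then show "\<rho> (artin_embedding n b) = burau n b"
    using artin_embedding_in_conj_aut_group[OF b] by (simp add: burau_conv_jacobian)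
qed

end
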